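(* Let $\psi(t)=2^{\sqrt{\log_2(1+t)}}-1$, $t\ge0$. There exists a positive Connes-Dixmier measurable operator $T_0\in\mathcal M_\psi$ such that the limit $$\lim_{n\to\infty}\frac{1}{\psi(n+1)}\sum_{k=0}^n\mu(k,T_0)$$ does not exist.
   Context: Notation: $\log$ is the natural logarithm and $\log_2$ the logarithm with base $2$. $H$ is an infinite-dimensional separable Hilbert space and $B(H)$ is the algebra of bounded linear operators on $H$. For a compact operator $T\in B(H)$, $\mu(k,T)$, $k=0,1,2,\ldots$, denotes the $k$-th singular value of $T$, i.e. the eigenvalues of $|T|$ arranged in decreasing order counted with multiplicity, starting with index $0$. $\Omega$ is the set of all concave functions $\psi:[0,\infty)\to[0,\infty)$ with $\lim_{t\to0+}\psi(t)=0$ and $\lim_{t\to\infty}\psi(t)=\infty$. For $\psi\in\Omega$, the Marcinkiewicz ideal $\mathcal M_\psi$ is the set of all compact operators $T\in B(H)$ with $$\|T\|_{\mathcal M_\psi}:=\sup_{n\ge0}\frac{1}{\psi(1+n)}\sum_{k=0}^n\mu(k,T)<\infty.$$ The function $\psi(t)=2^{\sqrt{\log_2(1+t)}}-1$ belongs to $\Omega$ and satisfies $\lim_{t\to\infty}\psi(2t)/\psi(t)=1$. Generalized limits: $l_\infty$ is the space of bounded sequences $x=(x_0,x_1,\ldots)$ with the sup norm, and $L_\infty=L_\infty(0,\infty)$ is the space of real-valued bounded Lebesgue measurable functions on $(0,\infty)$ with the essential sup norm. A generalized limit on $l_\infty$ (respectively, on $L_\infty$) is a normalized positive linear functional on $l_\infty$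 (respectively, $L_\infty$) which equals the ordinary limit on convergent sequences (respectively, on functions convergent at infinity). For $n\in\mathbb N$ (so $n\ge1$) the dilation operator $\sigma_n:l_\infty\to l_\infty$ is $$\sigma_n(x_0,x_1,\ldots)=(\underbrace{x_0,\ldots,x_0}_{n},\underbrace{x_1,\ldots,x_1}_{n},\ldots).$$ A generalized limit $\omega$ on $l_\infty$ is dilation invariant if $\omega(\sigma_n x)=\omega(x)$ for all $x\in l_\infty$ and all $n\in\mathbb N$. Dixmier traces: let $\psi\in\Omega$ satisfy $\liminf_{t\to\infty}\psi(2t)/\psi(t)=1$. For every dilation invariant generalized limit $\omega$ on $l_\infty$ satisfying $\omega\left(\left\{\frac{\psi(2n)}{\psi(n)}\right\}_n\right)=1$ (the value assigned to the term $n=0$ is immaterial), the weight $${\rm Tr}_\omega(T):=\omega\left(\left\{\frac{1}{\psi(1+n)}\sum_{k=0}^n\mu(k,T)\right\}_{n=0}^\infty\right),\quad 0\le T\in\mathcal M_\psi,$$ extends by linearity to a trace on $\mathcal M_\psi$, called a Dixmier trace. Connes-Dixmier traces: let $\pi:l_\infty\to L_\infty$ be $\pi(\{x_n\}_{n\ge0})=\sum_{n=0}^\infty x_n\chi_{(n,n+1]}$ and let $M:L_\infty\to L_\infty$ be the bounded operator $$(Mx)(t):=\frac1{\log t}\int_1^t x(s)\,\frac{ds}{s}.$$ For every generalized limit $\gamma$ on $L_\infty$, the functional $\omega=\gamma\circ M\circ\pi$ is a dilation invariant generalized limit on $l_\infty$. $\mathcal C$ is the set of all Dixmier traces ${\rm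 Tr}_\omega$ on $\mathcal M_\psi$ with $\omega$ of the form $\gamma\circ M\circ\pi$ (and satisfying $\omega(\{\psi(2n)/\psi(n)\}_n)=1$); its elements are called Connes-Dixmier traces. An operator $T\in\mathcal M_\psi$ is called Connes-Dixmier measurable if ${\rm Tr}_\omega(T)$ takes the same value for all ${\rm Tr}_\omega\in\mathcal C$. *)

theory Defs
  imports "HOL-Analysis.Analysis"
begin

section \<open>Complex Hilbert spaces\<close>

class complex_inner = real_normed_vector +
  fixes scaleC :: "complex \<Rightarrow> 'a \<Rightarrow> 'a" (infixr "*\<^sub>C" 75)
    and cinner :: "'a \<Rightarrow> 'a \<Rightarrow> complex"
  assumes scaleC_add_right: "a *\<^sub>C (x + y) = a *\<^sub>C x + a *\<^sub>C y"
    and scaleC_add_left: "(a + b) *\<^sub>C x = a *\<^sub>C x + b *\<^sub>C x"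
    and scaleC_scaleC: "a *\<^sub>C (b *\<^sub>C x) = (a * b) *\<^sub>C x"
    and scaleC_of_real: "complex_of_real r *\<^sub>C x = r *\<^sub>R x"
    and cinner_commute: "cinner x y = cnj (cinner y x)"
    and cinner_add_left: "cinner (x + y) z = cinner x z + cinner y z"
    and cinner_scaleC_left: "cinner (a *\<^sub>C x) y = a * cinner x y"
    and cinner_self: "cinner x x = complex_of_real ((norm x)\<^sup>2)"

class complex_hilbert_space = complex_inner + complete_space

global_interpretation complex_space: vector_space "scaleC :: complex \<Rightarrow> 'a \<Rightarrow> 'a::complex_inner"
  defines cspan = complex_space.span
    and cdim = complex_space.dim
proof
  show "1 *\<^sub>C x = x" for x :: 'a
    using scaleC_of_real[of 1 x] by simp
qed (simp_all add: scaleC_add_right scaleC_add_left scaleC_scaleC)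

definition infinite_dimensional :: "'h::complex_inner itself \<Rightarrow> bool" where
  "infinite_dimensional _ \<longleftrightarrow> \<not> (\<exists>B::'h set. finite B \<and> cspan B = UNIV)"

definition separable :: "'h::complex_inner itself \<Rightarrow> bool" where
  "separable _ \<longleftrightarrow> (\<exists>D::'h set. countable D \<and> closure D = UNIV)"


section \<open>Bounded and compact operators, singular values\<close>

definition bounded_op :: "('h::complex_inner \<Rightarrow> 'h) \<Rightarrow> bool" where
  "bounded_op T \<longleftrightarrow> bounded_linear T \<and> (\<forall>c x. T (c *\<^sub>C x) = c *\<^sub>C T x)"

definition compact_op :: "('h::complex_inner \<Rightarrow> 'h) \<Rightarrow> bool" where
  "compact_op T \<longleftrightarrow> bounded_op T \<and> compact (closure (T ` cball 0 1))"

definition positive_op :: "('h::complex_inner \<Rightarrow> 'h) \<Rightarrow> bool" where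
  "positive_op T \<longleftrightarrow> bounded_op T \<and> (\<forall>x. cinner (T x) x \<in> \<real> \<and> 0 \<le> Re (cinner (T x) x))"

definition adjoint_op :: "('h::complex_inner \<Rightarrow> 'h) \<Rightarrow> 'h \<Rightarrow> 'h" where
  "adjoint_op T = (THE S. bounded_op S \<and> (\<forall>x y. cinner (T x) y = cinner x (S y)))"

definition abs_op :: "('h::complex_inner \<Rightarrow> 'h) \<Rightarrow> 'h \<Rightarrow> 'h" where
  "abs_op T = (THE S. positive_op S \<and> S \<circ> S = adjoint_op T \<circ> T)"

definition eigenspace :: "('h::complex_inner \<Rightarrow> 'h) \<Rightarrow> real \<Rightarrow> 'h set" where
  "eigenspace A l = {x. A x = l *\<^sub>R x}"

text \<open>The eigenvalues of a positive compact operator \<open>A\<close> in decreasing order, each positive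
  eigenvalue being listed as often as its (finite) multiplicity. If only finitely many eigenvalues
  (with multiplicity) are positive, the list continues with zeros; otherwise \<open>0\<close> never occurs
  in it.\<close>

definition eigenvalue_sequence :: "('h::complex_inner \<Rightarrow> 'h) \<Rightarrow> (nat \<Rightarrow> real) \<Rightarrow> bool" where
  "eigenvalue_sequence A s \<longleftrightarrow>
     decseq s \<and> (\<forall>k. 0 \<le> s k) \<and>
     (\<forall>l>0. finite {k. s k = l} \<and> card {k. s k = l} = cdim (eigenspace A l))"

definition singular_value :: "nat \<Rightarrow> ('h::complex_inner \<Rightarrow> 'h) \<Rightarrow> real" where
  "singular_value k T = (THE s. eigenvalue_sequence (abs_op T) s) k"


section \<open>Marcinkiewicz ideals\<close>

definition singular_mean :: "(real \<Rightarrow> real) \<Rightarrow> ('h::complex_inner \<Rightarrow> 'h) \<Rightarrow> nat \<Rightarrow> real" where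
  "singular_mean \<psi> T n = 1 / \<psi> (1 + real n) * (\<Sum>k=0..n. singular_value k T)"

definition marcinkiewicz :: "(real \<Rightarrow> real) \<Rightarrow> ('h::complex_inner \<Rightarrow> 'h) set" where
  "marcinkiewicz \<psi> = {T. compact_op T \<and> bdd_above (range (singular_mean \<psi> T))}"


section \<open>Generalized limits\<close>

definition l_infinity :: "(nat \<Rightarrow> real) set" where
  "l_infinity = {x. bounded (range x)}"

text \<open>Elements of \<open>L\<^sub>\<infinity>(0,\<infinity>)\<close> are represented by functions on the whole real line whose values
  outside \<open>(0,\<infinity>)\<close> are irrelevant.\<close>

definition L_infinity :: "(real \<Rightarrow> real) set" where
  "L_infinity = {f. f \<in> borel_measurable (lebesgue_on {0<..}) \<and>
                    (\<exists>C. AE t in lebesgue_on {0<..}. \<bar>f t\<bar> \<le> C)}"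

definition gen_limit_seq :: "((nat \<Rightarrow> real) \<Rightarrow> real) \<Rightarrow> bool" where
  "gen_limit_seq \<omega> \<longleftrightarrow>
     (\<forall>x\<in>l_infinity. \<forall>y\<in>l_infinity. \<omega> (\<lambda>n. x n + y n) = \<omega> x + \<omega> y) \<and>
     (\<forall>c. \<forall>x\<in>l_infinity. \<omega> (\<lambda>n. c * x n) = c * \<omega> x) \<and>
     (\<forall>x\<in>l_infinity. (\<forall>n. 0 \<le> x n) \<longrightarrow> 0 \<le> \<omega> x) \<and>
     \<omega> (\<lambda>n. 1) = 1 \<and>
     (\<forall>x l. x \<longlonglongrightarrow> l \<longrightarrow> \<omega> x = l)"

text \<open>Positivity is required with respect to the almost-everywhere order. Together with linearity
  this makes \<open>\<gamma>\<close> agree on functions that are equal almost everywhere on \<open>(0,\<infinity>)\<close>, so that it is a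
  functional on the space of equivalence classes.\<close>

definition gen_limit_fun :: "((real \<Rightarrow> real) \<Rightarrow> real) \<Rightarrow> bool" where
  "gen_limit_fun \<gamma> \<longleftrightarrow>
     (\<forall>f\<in>L_infinity. \<forall>g\<in>L_infinity. \<gamma> (\<lambda>t. f t + g t) = \<gamma> f + \<gamma> g) \<and>
     (\<forall>c. \<forall>f\<in>L_infinity. \<gamma> (\<lambda>t. c * f t) = c * \<gamma> f) \<and>
     (\<forall>f\<in>L_infinity. (AE t in lebesgue_on {0<..}. 0 \<le> f t) \<longrightarrow> 0 \<le> \<gamma> f) \<and>
     \<gamma> (\<lambda>t. 1) = 1 \<and>
     (\<forall>f\<in>L_infinity. \<forall>l. (f \<longlongrightarrow> l) at_top \<longrightarrow> \<gamma> f = l)"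

definition dilation :: "nat \<Rightarrow> (nat \<Rightarrow> real) \<Rightarrow> nat \<Rightarrow> real" where
  "dilation n x k = x (k div n)"

definition dilation_invariant :: "((nat \<Rightarrow> real) \<Rightarrow> real) \<Rightarrow> bool" where
  "dilation_invariant \<omega> \<longleftrightarrow> (\<forall>x\<in>l_infinity. \<forall>n\<ge>1. \<omega> (dilation n x) = \<omega> x)"

definition step_fun :: "(nat \<Rightarrow> real) \<Rightarrow> real \<Rightarrow> real" where
  "step_fun x t = (\<Sum>n. x n * indicator {real n<..real n + 1} t)"

definition log_mean :: "(real \<Rightarrow> real) \<Rightarrow> real \<Rightarrow> real" where
  "log_mean x t =
     1 / ln t * interval_lebesgue_integral lebesgue (ereal 1) (ereal t) (\<lambda>s. x s / s)"


section \<open>Dixmier and Connes-Dixmier traces\<close>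

definition dixmier_weight ::
  "(real \<Rightarrow> real) \<Rightarrow> ((nat \<Rightarrow> real) \<Rightarrow> real) \<Rightarrow> ('h::complex_inner \<Rightarrow> 'h) \<Rightarrow> real" where
  "dixmier_weight \<psi> \<omega> T = \<omega> (singular_mean \<psi> T)"

definition real_part_op :: "('h::complex_inner \<Rightarrow> 'h) \<Rightarrow> 'h \<Rightarrow> 'h" where
  "real_part_op T x = (1 / 2) *\<^sub>C (T x + adjoint_op T x)"

definition imag_part_op :: "('h::complex_inner \<Rightarrow> 'h) \<Rightarrow> 'h \<Rightarrow> 'h" where
  "imag_part_op T x = (1 / (2 * \<i>)) *\<^sub>C (T x - adjoint_op T x)"

definition pos_part_op :: "('h::complex_inner \<Rightarrow> 'h) \<Rightarrow> 'h \<Rightarrow> 'h" where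
  "pos_part_op A x = (1 / 2) *\<^sub>C (abs_op A x + A x)"

definition neg_part_op :: "('h::complex_inner \<Rightarrow> 'h) \<Rightarrow> 'h \<Rightarrow> 'h" where
  "neg_part_op A x = (1 / 2) *\<^sub>C (abs_op A x - A x)"

text \<open>The extension by linearity of the additive weight from the positive cone, written out through
  \<open>T = (Re T)\<^sub>+ - (Re T)\<^sub>- + \<i> (Im T)\<^sub>+ - \<i> (Im T)\<^sub>-\<close>.\<close>

definition dixmier_trace ::
  "(real \<Rightarrow> real) \<Rightarrow> ((nat \<Rightarrow> real) \<Rightarrow> real) \<Rightarrow> ('h::complex_inner \<Rightarrow> 'h) \<Rightarrow> complex" where
  "dixmier_trace \<psi> \<omega> T =
     Complex
       (dixmier_weight \<psi> \<omega> (pos_part_op (real_part_op T)) -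
        dixmier_weight \<psi> \<omega> (neg_part_op (real_part_op T)))
       (dixmier_weight \<psi> \<omega> (pos_part_op (imag_part_op T)) -
        dixmier_weight \<psi> \<omega> (neg_part_op (imag_part_op T)))"

text \<open>The term with \<open>n = 0\<close> of \<open>\<psi>(2n)/\<psi>(n)\<close> does not influence the value of a generalized limit.\<close>

definition dixmier_limit :: "(real \<Rightarrow> real) \<Rightarrow> ((nat \<Rightarrow> real) \<Rightarrow> real) \<Rightarrow> bool" where
  "dixmier_limit \<psi> \<omega> \<longleftrightarrow> gen_limit_seq \<omega> \<and> dilation_invariant \<omega> \<and>
     \<omega> (\<lambda>n. \<psi> (2 * real n) / \<psi> (real n)) = 1"

definition connes_dixmier_traces ::
  "(real \<Rightarrow> real) \<Rightarrow> (('h::complex_inner \<Rightarrow> 'h) \<Rightarrow> complex) set" where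
  "connes_dixmier_traces \<psi> =
     {dixmier_trace \<psi> \<omega> | \<omega> \<gamma>.
        gen_limit_fun \<gamma> \<and> \<omega> = \<gamma> \<circ> log_mean \<circ> step_fun \<and> dixmier_limit \<psi> \<omega>}"

definition connes_dixmier_measurable ::
  "(real \<Rightarrow> real) \<Rightarrow> ('h::complex_inner \<Rightarrow> 'h) \<Rightarrow> bool" where
  "connes_dixmier_measurable \<psi> T \<longleftrightarrow> T \<in> marcinkiewicz \<psi> \<and>
     (\<forall>\<tau>\<in>connes_dixmier_traces \<psi>. \<forall>\<tau>'\<in>connes_dixmier_traces \<psi>. \<tau> T = \<tau>' T)"

end

theory Submission
  imports Defs "HOL-Real_Asymp.Real_Asymp"
begin

text \<open>
  A Connes-Dixmier trace sees the normalised partial sums \<open>x n\<close> of the singular values only through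
  their logarithmic mean, and the logarithmic mean forgets any bounded change of \<open>x\<close> on a set of
  logarithmic density zero. So it suffices to find singular values for which \<open>x n = 1\<close> off such a
  set, while \<open>x n\<close> stays away from \<open>1\<close> at infinitely many places of that set.

  The growth of \<open>\<psi>\<close> leaves room for this. Put \<open>knot m = 2 ^ (m\<^sup>2) - 1\<close>, so that
  \<open>\<psi> (knot m) = 2 ^ m - 1\<close>: from one knot to the next \<open>\<psi>\<close> roughly doubles. The logarithmic length of
  the block between the knots \<open>m\<close> and \<open>m + 1\<close> is of order \<open>m\<close>, whereas everything up to that block
  has logarithmic length of order \<open>m\<^sup>2\<close>. Hence the union of the blocks whose index is a power of two
  has logarithmic density zero: up to the knot \<open>m\<close> it has length of order \<open>m\<close>, since a sum of
  distinct powers of two is at most twice the largest of them (\<open>sum_powers_of_two_le\<close>,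
  \<open>log_length_block\<close>).

  On precisely these blocks \<open>\<psi>\<close> is replaced by its chord. The chord agrees with \<open>\<psi>\<close> at
  both knots, but it gains almost all of its height near the right end, so halfway through the block
  on the logarithmic scale it is still close to \<open>2 ^ m\<close>, whereas \<open>\<psi>\<close> has grown there by a factor
  near \<open>sqrt 2\<close>. This destroys convergence of \<open>x\<close> (\<open>flattened_ratio_not_convergent\<close>) but not
  convergence of its logarithmic mean (\<open>log_mean_flattened_ratio\<close>). As \<open>\<psi>\<close> is concave, the
  modified function is concave as well; thus its increments decrease, and they are
  the singular values of a diagonal operator on an orthonormal sequence.

  On the operator side the singular values and the traces are defined through descriptions of the
  adjoint, the absolute value and the eigenvalue sequence, so each of these needs a uniqueness
  argument. The essential one is that a positive square root of the square of a diagonal operator is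
  that operator (\<open>abs_diag_op\<close>): every eigenvector of a square \<open>S\<^sup>2\<close> with \<open>S\<close> positive is an
  eigenvector of \<open>S\<close> itself.
\<close>


section \<open>Geometry of complex inner product spaces\<close>

lemma cinner_add_right:
  fixes x :: "'a::complex_inner"
  shows "cinner x (y + z) = cinner x y + cinner x z"
  by (metis cinner_add_left cinner_commute complex_cnj_add)

lemma cinner_scaleC_right:
  fixes x :: "'a::complex_inner"
  shows "cinner x (a *\<^sub>C y) = cnj a * cinner x y"
  by (metis cinner_commute cinner_scaleC_left complex_cnj_mult)

lemma linear_cinner_left:
  fixes y :: "'a::complex_inner"
  shows "linear (\<lambda>x. cinner x y)"
  by (rule linearI) (simp_all add: cinner_add_left cinner_scaleC_left scaleR_conv_of_real
      flip: scaleC_of_real)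

lemma linear_cinner_right:
  fixes x :: "'a::complex_inner"
  shows "linear (cinner x)"
  by (rule linearI) (simp_all add: cinner_add_right cinner_scaleC_right scaleR_conv_of_real
      flip: scaleC_of_real)

lemmas cinner_simps =
  cinner_add_left cinner_add_right cinner_scaleC_left cinner_scaleC_right
  linear_diff[OF linear_cinner_left] linear_diff[OF linear_cinner_right]
  linear_0[OF linear_cinner_left] linear_0[OF linear_cinner_right]
  linear_sum[OF linear_cinner_left] linear_sum[OF linear_cinner_right]

lemma cinner_self_eq_0:
  fixes x :: "'a::complex_inner"
  shows "cinner x x = 0 \<longleftrightarrow> x = 0"
  by (simp add: cinner_self)

lemma norm_scaleC:
  fixes x :: "'a::complex_inner"
  shows "norm (c *\<^sub>C x) = cmod c * norm x"
proof -
  have "complex_of_real ((norm (c *\<^sub>C x))\<^sup>2) = complex_of_real ((cmod c * norm x)\<^sup>2)"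
    unfolding cinner_self[symmetric] power_mult_distrib of_real_mult complex_norm_square
    by (simp add: cinner_simps)
  then show ?thesis
    unfolding of_real_eq_iff by (rule power2_eq_imp_eq) auto
qed

text \<open>The Cauchy-Schwarz inequality, from the squared norm of the component of \<open>x\<close> orthogonal
  to \<open>y\<close>.\<close>

lemma norm_cinner_le:
  fixes x y :: "'a::complex_inner"
  shows "cmod (cinner x y) \<le> norm x * norm y"
proof (cases "y = 0")
  case False
  define c where "c = cinner x y / complex_of_real ((norm y)\<^sup>2)"
  define z where "z = x - c *\<^sub>C y"
  have "cinner z y = 0"
    using False by (simp add: z_def c_def cinner_simps cinner_self)
  then have "cinner z z = cinner x x - c * cinner y x"
    by (simp add: z_def cinner_simps)
  also have "c * cinner y x = complex_of_real ((cmod (cinner x y))\<^sup>2 / (norm y)\<^sup>2)"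
    by (subst cinner_commute) (simp add: c_def complex_norm_square del: of_real_power)
  finally have "complex_of_real ((norm z)\<^sup>2)
      = complex_of_real ((norm x)\<^sup>2 - (cmod (cinner x y))\<^sup>2 / (norm y)\<^sup>2)"
    by (simp add: cinner_self)
  then have "(norm z)\<^sup>2 = (norm x)\<^sup>2 - (cmod (cinner x y))\<^sup>2 / (norm y)\<^sup>2"
    unfolding of_real_eq_iff .
  then have "(cmod (cinner x y))\<^sup>2 / (norm y)\<^sup>2 \<le> (norm x)\<^sup>2"
    using zero_le_power2[of "norm z"] by linarith
  then have "(cmod (cinner x y))\<^sup>2 \<le> (norm x * norm y)\<^sup>2"
    using False by (simp add: divide_le_eq power_mult_distrib)
  then show ?thesis
    by (rule power2_le_imp_le) simp
qed (simp add: cinner_simps)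

lemma bounded_linear_cinner_left:
  fixes y :: "'a::complex_inner"
  shows "bounded_linear (\<lambda>x. cinner x y)"
  by (rule bounded_linear_intro[where K = "norm y"])
    (simp_all add: linear_add[OF linear_cinner_left] linear_scale[OF linear_cinner_left] norm_cinner_le)

lemma bounded_linear_scaleC:
  shows "bounded_linear (\<lambda>x::'a::complex_inner. c *\<^sub>C x)"
  by (rule bounded_linear_intro[where K = "cmod c"])
    (simp_all add: norm_scaleC scaleC_add_right scaleC_scaleC mult.commute flip: scaleC_of_real)

lemma scaleC_simps [simp]:
  fixes x :: "'a::complex_inner"
  shows "1 *\<^sub>C x = x" "0 *\<^sub>C x = 0"
  using scaleC_of_real[of 1 x] scaleC_of_real[of 0 x] by simp_all


section \<open>Orthonormal sequences\<close>

definition orthonormal_seq :: "(nat \<Rightarrow> 'a::complex_inner) \<Rightarrow> bool" where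
  "orthonormal_seq e \<longleftrightarrow> (\<forall>i j. cinner (e i) (e j) = (if i = j then 1 else 0))"

lemma norm_sum_orthonormal:
  assumes "orthonormal_seq e" "finite F"
  shows "(norm (\<Sum>k\<in>F. c k *\<^sub>C e k))\<^sup>2 = (\<Sum>k\<in>F. (cmod (c k))\<^sup>2)"
proof -
  have "complex_of_real ((norm (\<Sum>k\<in>F. c k *\<^sub>C e k))\<^sup>2)
      = (\<Sum>i\<in>F. \<Sum>j\<in>F. cnj (c i) * (c j * cinner (e j) (e i)))"
    by (simp add: cinner_simps sum_distrib_left flip: cinner_self del: of_real_power)
  also have "\<dots> = (\<Sum>i\<in>F. \<Sum>j\<in>F. if i = j then cnj (c i) * c i else 0)"
    using assms(1) by (intro sum.cong refl) (auto simp: orthonormal_seq_def)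
  also have "\<dots> = complex_of_real (\<Sum>k\<in>F. (cmod (c k))\<^sup>2)"
    using assms(2) by (simp add: complex_norm_square mult.commute del: of_real_power)
  finally show ?thesis
    unfolding of_real_eq_iff .
qed

lemma Bessel_finite:
  assumes "orthonormal_seq e" "finite F"
  shows "(\<Sum>k\<in>F. (cmod (cinner x (e k)))\<^sup>2) \<le> (norm x)\<^sup>2"
proof -
  define y where "y = (\<Sum>k\<in>F. cinner x (e k) *\<^sub>C e k)"
  have yy: "cinner y y = complex_of_real (\<Sum>k\<in>F. (cmod (cinner x (e k)))\<^sup>2)"
    unfolding cinner_self y_def norm_sum_orthonormal[OF assms] ..
  have xy: "cinner x y = complex_of_real (\<Sum>k\<in>F. (cmod (cinner x (e k)))\<^sup>2)"
    by (simp add: y_def cinner_simps complex_norm_square mult.commute del: of_real_power)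
  have yx: "cinner y x = complex_of_real (\<Sum>k\<in>F. (cmod (cinner x (e k)))\<^sup>2)"
    by (subst cinner_commute) (simp add: xy)
  have "complex_of_real ((norm (x - y))\<^sup>2)
      = complex_of_real ((norm x)\<^sup>2 - (\<Sum>k\<in>F. (cmod (cinner x (e k)))\<^sup>2))"
    unfolding cinner_self[symmetric]
    by (simp only: cinner_simps xy yx yy of_real_diff) (simp add: cinner_self)
  then have "(norm (x - y))\<^sup>2 = (norm x)\<^sup>2 - (\<Sum>k\<in>F. (cmod (cinner x (e k)))\<^sup>2)"
    unfolding of_real_eq_iff .
  then show ?thesis
    using zero_le_power2[of "norm (x - y)"] by linarith
qed

text \<open>Gram-Schmidt, carried out as a dependent choice: no finite part of the sequence spans the
  space, so a vector outside its span, with its components along that part removed, can be normalised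
  to give the next member.\<close>

lemma orthonormal_seq_exists:
  assumes "infinite_dimensional TYPE('h::complex_inner)"
  shows "\<exists>e :: nat \<Rightarrow> 'h. orthonormal_seq e"
proof -
  let ?P = "\<lambda>(f::nat \<Rightarrow> 'h) n r. cinner r r = 1 \<and> (\<forall>i<n. cinner r (f i) = 0)"
  have "\<exists>f. \<forall>n. ?P f n (f n)"
  proof (rule dependent_wellorder_choice)
    fix r :: 'h and f g :: "nat \<Rightarrow> 'h" and n
    assume "\<And>y. y < n \<Longrightarrow> f y = g y"
    then show "?P f n r = ?P g n r" by auto
  next
    fix f :: "nat \<Rightarrow> 'h" and n
    assume IH: "\<And>m. m < n \<Longrightarrow> ?P f m (f m)"
    have orth: "cinner (f i) (f j) = (if i = j then 1 else 0)" if "i < n" "j < n" for i j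
      using IH[OF that(1)] IH[OF that(2)] that
      by (cases i j rule: linorder_cases) (auto, metis cinner_commute complex_cnj_zero)
    have "cspan (f ` {..<n}) \<noteq> UNIV"
      using assms unfolding infinite_dimensional_def by blast
    then obtain x where x: "x \<notin> cspan (f ` {..<n})" by blast
    define v where "v = x - (\<Sum>i<n. cinner x (f i) *\<^sub>C f i)"
    have "(\<Sum>i<n. cinner x (f i) *\<^sub>C f i) \<in> cspan (f ` {..<n})"
      by (intro complex_space.span_sum complex_space.span_scale complex_space.span_base) auto
    with x have "v \<noteq> 0" unfolding v_def by auto
    have vf: "cinner v (f j) = 0" if "j < n" for j
    proof -
      have "(\<Sum>i<n. cinner x (f i) * cinner (f i) (f j)) = (\<Sum>i<n. if i = j then cinner x (f j) else 0)"
        using that by (intro sum.cong) (auto simp: orth)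
      then show ?thesis using that by (simp add: v_def cinner_simps)
    qed
    define r where "r = complex_of_real (1 / norm v) *\<^sub>C v"
    have "?P f n r"
      using \<open>v \<noteq> 0\<close> vf by (auto simp: r_def cinner_simps cinner_self power2_eq_square norm_scaleC norm_divide)
    then show "\<exists>r. ?P f n r" by blast
  qed
  then obtain e where e: "\<And>n. ?P e n (e n)" by blast
  have "cinner (e i) (e j) = (if i = j then 1 else 0)" for i j
    using e[of i] e[of j]
    by (cases i j rule: linorder_cases) (auto, metis cinner_commute complex_cnj_zero)
  then show ?thesis unfolding orthonormal_seq_def by blast
qed


section \<open>Diagonal operators\<close>

subclass (in complex_hilbert_space) banach ..

definition diag_op :: "(nat \<Rightarrow> 'h) \<Rightarrow> (nat \<Rightarrow> real) \<Rightarrow> 'h \<Rightarrow> 'h::complex_hilbert_space" where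
  "diag_op e s x = (\<Sum>k. (complex_of_real (s k) * cinner x (e k)) *\<^sub>C e k)"

context
  fixes e :: "nat \<Rightarrow> 'h::complex_hilbert_space"
  assumes e: "orthonormal_seq e"
begin

lemma cinner_orthonormal: "cinner (e i) (e j) = (if i = j then 1 else 0)"
  using e by (simp add: orthonormal_seq_def)

text \<open>By Pythagoras and Bessel, a section of the diagonal series is controlled by the supremum of
  the coefficients on that section. This one estimate gives the boundedness of the operator and its
  approximation by finite sections.\<close>

lemma norm_diag_sum_le:
  assumes "finite F" "\<And>k. k \<in> F \<Longrightarrow> \<bar>s k\<bar> \<le> C" "0 \<le> C"
  shows "norm (\<Sum>k\<in>F. (complex_of_real (s k) * cinner x (e k)) *\<^sub>C e k) \<le> C * norm x"
proof (rule power2_le_imp_le)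
  have "(norm (\<Sum>k\<in>F. (complex_of_real (s k) * cinner x (e k)) *\<^sub>C e k))\<^sup>2
      = (\<Sum>k\<in>F. \<bar>s k\<bar>\<^sup>2 * (cmod (cinner x (e k)))\<^sup>2)"
    by (simp add: norm_sum_orthonormal[OF e assms(1)] norm_mult power_mult_distrib)
  also have "\<dots> \<le> (\<Sum>k\<in>F. C\<^sup>2 * (cmod (cinner x (e k)))\<^sup>2)"
    using assms by (intro sum_mono mult_right_mono power_mono) auto
  also have "\<dots> = C\<^sup>2 * (\<Sum>k\<in>F. (cmod (cinner x (e k)))\<^sup>2)"
    by (simp add: sum_distrib_left)
  also have "\<dots> \<le> C\<^sup>2 * (norm x)\<^sup>2"
    by (intro mult_left_mono Bessel_finite[OF e assms(1)]) auto
  finally show "(norm (\<Sum>k\<in>F. (complex_of_real (s k) * cinner x (e k)) *\<^sub>C e k))\<^sup>2 \<le> (C * norm x)\<^sup>2"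
    by (simp add: power_mult_distrib)
qed (use assms in auto)

lemma summable_Bessel: "summable (\<lambda>k. (cmod (cinner x (e k)))\<^sup>2)"
  by (rule summableI_nonneg_bounded[where x = "(norm x)\<^sup>2"]) (auto intro: Bessel_finite[OF e])

text \<open>Absolute convergence may fail here, so the Cauchy criterion is checked through
  Pythagoras.\<close>

lemma summable_orthonormal:
  assumes "summable (\<lambda>k. (cmod (c k))\<^sup>2)"
  shows "summable (\<lambda>k. c k *\<^sub>C e k)"
  unfolding summable_Cauchy
proof (intro allI impI)
  fix \<epsilon> :: real assume "0 < \<epsilon>"
  then obtain N where N: "\<And>m n. m \<ge> N \<Longrightarrow> norm (\<Sum>k=m..<n. (cmod (c k))\<^sup>2) < \<epsilon>\<^sup>2"
    using assms unfolding summable_Cauchy by (meson zero_less_power)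
  have "norm (\<Sum>k=m..<n. c k *\<^sub>C e k) < \<epsilon>" if "m \<ge> N" for m n
  proof (rule power2_less_imp_less)
    show "(norm (\<Sum>k=m..<n. c k *\<^sub>C e k))\<^sup>2 < \<epsilon>\<^sup>2"
      using N[OF that, of n] by (simp add: norm_sum_orthonormal[OF e] sum_nonneg)
  qed (use \<open>0 < \<epsilon>\<close> in simp)
  then show "\<exists>N. \<forall>m\<ge>N. \<forall>n. norm (\<Sum>k=m..<n. c k *\<^sub>C e k) < \<epsilon>" by blast
qed

context
  fixes s :: "nat \<Rightarrow> real" and C :: real
  assumes s_bound: "\<forall>k. \<bar>s k\<bar> \<le> C"
begin

lemma diag_op_sums: "(\<lambda>k. (complex_of_real (s k) * cinner x (e k)) *\<^sub>C e k) sums diag_op e s x"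
  unfolding diag_op_def
proof (rule summable_sums, rule summable_orthonormal)
  show "summable (\<lambda>k. (cmod (complex_of_real (s k) * cinner x (e k)))\<^sup>2)"
  proof (rule summable_comparison_test'[where N = 0])
    show "summable (\<lambda>k. C\<^sup>2 * (cmod (cinner x (e k)))\<^sup>2)"
      by (intro summable_mult summable_Bessel)
    show "norm ((cmod (complex_of_real (s k) * cinner x (e k)))\<^sup>2) \<le> C\<^sup>2 * (cmod (cinner x (e k)))\<^sup>2" for k
      using power_mono[OF s_bound[rule_format, of k], of 2]
      by (simp add: norm_mult power_mult_distrib mult_right_mono)
  qed
qed

lemma diag_op_eqI:
  assumes "(\<lambda>k. (complex_of_real (s k) * cinner x (e k)) *\<^sub>C e k) sums y"
  shows "diag_op e s x = y"
  using diag_op_sums assms by (rule sums_unique2)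

lemma diag_op_add: "diag_op e s (x + y) = diag_op e s x + diag_op e s y"
  using sums_add[OF diag_op_sums diag_op_sums]
  by (intro diag_op_eqI) (simp add: cinner_simps distrib_left flip: scaleC_add_left)

lemma diag_op_scaleC: "diag_op e s (c *\<^sub>C x) = c *\<^sub>C diag_op e s x"
  using bounded_linear.sums[OF bounded_linear_scaleC diag_op_sums]
  by (intro diag_op_eqI) (simp add: cinner_simps scaleC_scaleC mult.left_commute)

lemma norm_diag_op_tail:
  assumes "\<And>k. k \<ge> N \<Longrightarrow> \<bar>s k\<bar> \<le> \<epsilon>" "0 \<le> \<epsilon>"
  shows "norm (diag_op e s x - (\<Sum>k<N. (complex_of_real (s k) * cinner x (e k)) *\<^sub>C e k)) \<le> \<epsilon> * norm x"
proof (rule Lim_norm_ubound)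
  let ?f = "\<lambda>k. (complex_of_real (s k) * cinner x (e k)) *\<^sub>C e k"
  show "(\<lambda>n. (\<Sum>k<n. ?f k) - (\<Sum>k<N. ?f k)) \<longlonglongrightarrow> diag_op e s x - (\<Sum>k<N. ?f k)"
    using diag_op_sums unfolding sums_def by (intro tendsto_intros)
  have "norm ((\<Sum>k<n. ?f k) - (\<Sum>k<N. ?f k)) \<le> \<epsilon> * norm x" if "n \<ge> N" for n
  proof -
    have "(\<Sum>k<n. ?f k) - (\<Sum>k<N. ?f k) = (\<Sum>k\<in>{N..<n}. ?f k)"
      using that sum_diff_nat_ivl[of 0 N n ?f] by (simp add: lessThan_atLeast0)
    then show ?thesis
      using norm_diag_sum_le[of "{N..<n}" s \<epsilon> x] assms by simp
  qed
  then show "eventually (\<lambda>n. norm ((\<Sum>k<n. ?f k) - (\<Sum>k<N. ?f k)) \<le> \<epsilon> * norm x) sequentially"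
    unfolding eventually_sequentially by blast
qed simp

lemma bounded_op_diag_op: "bounded_op (diag_op e s)"
  unfolding bounded_op_def
proof
  have "0 \<le> C" using s_bound[rule_format, of 0] by simp
  then have "norm (diag_op e s x) \<le> norm x * C" for x
    using norm_diag_op_tail[of 0 C x] s_bound by (simp add: mult.commute)
  then show "bounded_linear (diag_op e s)"
    by (intro bounded_linear_intro[where K = C])
      (simp_all add: diag_op_add diag_op_scaleC flip: scaleC_of_real)
qed (simp add: diag_op_scaleC)

lemma cinner_diag_op_sums:
  "(\<lambda>k. complex_of_real (s k) * cinner x (e k) * cinner (e k) y) sums cinner (diag_op e s x) y"
  using bounded_linear.sums[OF bounded_linear_cinner_left diag_op_sums]
  by (simp add: cinner_simps)

lemma cinner_diag_op_basis: "cinner (diag_op e s x) (e j) = s j * cinner x (e j)"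
proof -
  have "(\<lambda>k. if k = j then complex_of_real (s j) * cinner x (e j) else 0) sums cinner (diag_op e s x) (e j)"
    by (rule sums_cong[THEN iffD1, OF _ cinner_diag_op_sums]) (simp add: cinner_orthonormal)
  with sums_single[of j "\<lambda>k. complex_of_real (s j) * cinner x (e j)"] show ?thesis
    by (simp add: sums_unique2)
qed

lemma diag_op_basis: "diag_op e s (e j) = complex_of_real (s j) *\<^sub>C e j"
proof (rule diag_op_eqI)
  have "(\<lambda>k. if k = j then complex_of_real (s j) *\<^sub>C e j else 0) sums (complex_of_real (s j) *\<^sub>C e j)"
    using sums_single[of j "\<lambda>k. complex_of_real (s j) *\<^sub>C e j"] by simp
  then show "(\<lambda>k. (complex_of_real (s k) * cinner (e j) (e k)) *\<^sub>C e k) sums (complex_of_real (s j) *\<^sub>C e j)"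
    by (rule sums_cong[THEN iffD1, rotated]) (simp add: cinner_orthonormal)
qed

lemma cinner_diag_op_commute: "cinner (diag_op e s x) y = cinner x (diag_op e s y)"
proof -
  have "(\<lambda>k. complex_of_real (s k) * cinner x (e k) * cinner (e k) y) sums cnj (cinner (diag_op e s y) x)"
    using bounded_linear.sums[OF bounded_linear_cnj cinner_diag_op_sums[of y x]]
    by (simp add: mult.assoc mult.left_commute mult.commute flip: cinner_commute)
  then show ?thesis
    using sums_unique2[OF cinner_diag_op_sums[of x y]] cinner_commute[of x] by simp
qed

lemma positive_diag_op:
  assumes "\<And>k. 0 \<le> s k"
  shows "positive_op (diag_op e s)"
  unfolding positive_op_def
proof (intro conjI allI bounded_op_diag_op)
  fix x
  show "cinner (diag_op e s x) x \<in> \<real>"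
    using cinner_commute[of "diag_op e s x" x] by (simp add: cinner_diag_op_commute Reals_cnj_iff)
  have "cinner x (e k) * cinner (e k) x = complex_of_real ((cmod (cinner x (e k)))\<^sup>2)" for k
    unfolding complex_norm_square cinner_commute[of "e k" x] by simp
  then have sums: "(\<lambda>k. complex_of_real (s k * (cmod (cinner x (e k)))\<^sup>2)) sums cinner (diag_op e s x) x"
    using cinner_diag_op_sums[of x x] by (simp add: mult.assoc)
  have "0 \<le> s k * (cmod (cinner x (e k)))\<^sup>2" for k
    using assms by simp
  moreover have "(\<lambda>k. s k * (cmod (cinner x (e k)))\<^sup>2) sums Re (cinner (diag_op e s x) x)"
    using sums_Re[OF sums] by (simp only: Re_complex_of_real)
  ultimately show "0 \<le> Re (cinner (diag_op e s x) x)"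
    by (rule sums_le[OF _ sums_zero])
qed

end

end


section \<open>Adjoints and positive square roots\<close>

lemma adjoint_op_eqI:
  fixes T S :: "'h::complex_inner \<Rightarrow> 'h"
  assumes "bounded_op S" and TS: "\<And>x y. cinner (T x) y = cinner x (S y)"
  shows "adjoint_op T = S"
  unfolding adjoint_op_def
proof (rule the_equality)
  fix R assume R: "bounded_op R \<and> (\<forall>x y. cinner (T x) y = cinner x (R y))"
  show "R = S"
  proof
    fix y
    have "cinner (R y - S y) (R y - S y) = 0"
      using R TS[of "R y - S y" y] by (simp add: cinner_simps)
    then show "R y = S y" by (simp add: cinner_self_eq_0)
  qed
qed (use assms in auto)

text \<open>Polarisation over the complex numbers: the defect of symmetry \<open>f\<close> vanishes on the diagonal,
  so it is antisymmetric, and replacing \<open>x\<close> by \<open>\<i> x\<close> shows that it is symmetric as well.\<close>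

lemma positive_op_selfadjoint:
  fixes S :: "'h::complex_inner \<Rightarrow> 'h"
  assumes "positive_op S"
  shows "cinner (S x) y = cinner x (S y)"
proof -
  have lin: "S (a + b) = S a + S b" "S (c *\<^sub>C a) = c *\<^sub>C S a" for a b c
    using assms unfolding positive_op_def bounded_op_def
    by (auto simp: linear_add[OF bounded_linear.linear])
  define f where "f a b = cinner (S a) b - cinner a (S b)" for a b
  have f0: "f a a = 0" for a
    using assms cinner_commute[of a "S a"]
    by (simp add: f_def positive_op_def Reals_cnj_iff)
  have "f x y + f y x = 0"
    using f0[of "x + y"] f0[of x] f0[of y] by (simp add: f_def lin cinner_simps algebra_simps)
  moreover have "f x y - f y x = 0"
  proof -
    have "\<i> * (f x y - f y x) = 0"
      using f0[of "\<i> *\<^sub>C x + y"] f0[of x] f0[of y]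
      by (simp add: f_def lin cinner_simps algebra_simps)
    then show ?thesis by simp
  qed
  ultimately have "f x y = 0" by simp
  then show ?thesis by (simp add: f_def)
qed

text \<open>The vector \<open>w = S v - l v\<close> satisfies \<open>S w = - l w\<close>, and a positive operator has no negative
  eigenvalue. For \<open>l = 0\<close> this says nothing; there \<open>\<parallel>S v\<parallel>\<^sup>2\<close> is the inner product of \<open>S (S v) = 0\<close>
  with \<open>v\<close>.\<close>

lemma positive_sqrt_eigenvector:
  fixes S :: "'h::complex_inner \<Rightarrow> 'h"
  assumes S: "positive_op S" and v: "S (S v) = complex_of_real (l\<^sup>2) *\<^sub>C v" and l: "0 \<le> l"
  shows "S v = complex_of_real l *\<^sub>C v"
proof -
  have lin: "S (a - b) = S a - S b" "S (c *\<^sub>C a) = c *\<^sub>C S a" for a b c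
    using S unfolding positive_op_def bounded_op_def
    by (auto simp: linear_diff[OF bounded_linear.linear])
  define w where "w = S v - complex_of_real l *\<^sub>C v"
  have "S w = - complex_of_real l *\<^sub>C w"
    by (simp add: w_def lin v scaleC_scaleC power2_eq_square complex_space.scale_right_diff_distrib
        complex_space.scale_minus_left)
  show ?thesis
  proof (cases "l = 0")
    case True
    have "cinner (S v) (S v) = cinner (S (S v)) v"
      using positive_op_selfadjoint[OF S] by simp
    then show ?thesis using True v by (simp add: cinner_simps cinner_self_eq_0)
  next
    case False
    have "cinner (S w) w = complex_of_real (- l * (norm w)\<^sup>2)"
      unfolding \<open>S w = _\<close> cinner_simps cinner_self by simp
    then have "0 \<le> - l * (norm w)\<^sup>2"
      using S unfolding positive_op_def by (metis Re_complex_of_real)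
    then have "w = 0"
      using False l by (simp add: mult_le_0_iff)
    then show ?thesis by (simp add: w_def)
  qed
qed


section \<open>Compactness, absolute value and eigenvalues of diagonal operators\<close>

lemma finite_frame_image_compact:
  fixes e :: "nat \<Rightarrow> 'h::complex_inner"
  shows "compact {\<Sum>k<N. c k *\<^sub>C e k | c. \<forall>k<N. cmod (c k) \<le> R}"
proof (induction N)
  case 0
  have "{\<Sum>k<0. c k *\<^sub>C e k | c. \<forall>k<0. cmod (c k) \<le> R} = {0}" by auto
  then show ?case by (simp only: compact_insert compact_empty)
next
  case (Suc N)
  let ?K = "{\<Sum>k<N. c k *\<^sub>C e k | c. \<forall>k<N. cmod (c k) \<le> R}"
  have "continuous_on (?K \<times> cball 0 R) (\<lambda>p. fst p + snd p *\<^sub>C e N)"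
  proof (intro continuous_intros)
    have "bounded_linear (\<lambda>c. c *\<^sub>C e N)"
      by (rule bounded_linear_intro[where K = "norm (e N)"])
        (simp_all add: norm_scaleC scaleC_add_left scaleC_scaleC scaleR_conv_of_real flip: scaleC_of_real)
    then show "continuous_on (?K \<times> cball 0 R) (\<lambda>p. snd p *\<^sub>C e N)"
      by (rule bounded_linear.continuous_on) (rule continuous_on_snd[OF continuous_on_id])
  qed
  then have "compact ((\<lambda>p. fst p + snd p *\<^sub>C e N) ` (?K \<times> cball 0 R))"
    using Suc by (intro compact_continuous_image compact_Times) auto
  also have "(\<lambda>p. fst p + snd p *\<^sub>C e N) ` (?K \<times> cball 0 R)
      = {\<Sum>k<Suc N. c k *\<^sub>C e k | c. \<forall>k<Suc N. cmod (c k) \<le> R}" (is "?L = ?M")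
  proof
    show "?M \<subseteq> ?L"
    proof
      fix y assume "y \<in> ?M"
      then obtain c where c: "y = (\<Sum>k<Suc N. c k *\<^sub>C e k)" "\<forall>k<Suc N. cmod (c k) \<le> R" by blast
      show "y \<in> ?L"
        by (rule image_eqI[of _ _ "(\<Sum>k<N. c k *\<^sub>C e k, c N)"]) (use c in auto)
    qed
    show "?L \<subseteq> ?M"
    proof
      fix y assume "y \<in> ?L"
      then obtain c z where c: "y = (\<Sum>k<N. c k *\<^sub>C e k) + z *\<^sub>C e N"
          "\<forall>k<N. cmod (c k) \<le> R" "cmod z \<le> R" by auto
      have "y = (\<Sum>k<Suc N. (c(N := z)) k *\<^sub>C e k)" using c by simp
      moreover have "\<forall>k<Suc N. cmod ((c(N := z)) k) \<le> R" using c by auto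
      ultimately show "y \<in> ?M" by blast
    qed
  qed
  finally show ?case .
qed

context
  fixes e :: "nat \<Rightarrow> 'h::complex_hilbert_space" and s :: "nat \<Rightarrow> real"
  assumes e: "orthonormal_seq e" and s_dec: "decseq s" and s_lim: "s \<longlonglongrightarrow> 0" and s_pos: "\<forall>k. 0 < s k"
begin

lemma abs_s_le: "\<forall>k. \<bar>s k\<bar> \<le> s 0"
  using decseqD[OF s_dec] s_pos by (simp add: less_imp_le)

text \<open>The image of the unit ball lies within \<open>\<epsilon> / 4\<close> of a compact subset of the span of finitely
  many members of the sequence, which makes it totally bounded.\<close>

lemma compact_diag_op: "compact_op (diag_op e s)"
  unfolding compact_op_def
proof
  let ?D = "diag_op e s"
  show "bounded_op ?D"
    using bounded_op_diag_op[OF e abs_s_le] .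
  have "\<exists>k. finite k \<and> closure (?D ` cball 0 1) \<subseteq> (\<Union>x\<in>k. ball x \<epsilon>)" if "0 < \<epsilon>" for \<epsilon>
  proof -
    have "eventually (\<lambda>k. s k < \<epsilon> / 4) sequentially"
      using s_lim by (rule order_tendstoD) (use \<open>0 < \<epsilon>\<close> in simp)
    then obtain N where N: "s N < \<epsilon> / 4"
      unfolding eventually_sequentially by blast
    let ?K = "{\<Sum>k<N. c k *\<^sub>C e k | c. \<forall>k<N. cmod (c k) \<le> s 0}"
    have "0 < \<epsilon> / 4" using \<open>0 < \<epsilon>\<close> by simp
    then obtain F where F: "finite F" "?K \<subseteq> (\<Union>x\<in>F. ball x (\<epsilon> / 4))"
      using finite_frame_image_compact[where N = N and e = e and R = "s 0"]
      unfolding compact_eq_totally_bounded by blast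
    have "?D ` cball 0 1 \<subseteq> (\<Union>x\<in>F. cball x (\<epsilon> / 2))"
    proof
      fix y assume "y \<in> ?D ` cball 0 1"
      then obtain x where x: "norm x \<le> 1" "y = ?D x" by auto
      define c where "c k = complex_of_real (s k) * cinner x (e k)" for k
      have "cmod (c k) \<le> s 0" for k
      proof -
        have "(norm (e k))\<^sup>2 = 1"
          using cinner_self[of "e k"] e by (simp add: orthonormal_seq_def flip: of_real_power)
        then have "norm (e k) = 1"
          using abs_square_eq_1[of "norm (e k)"] by simp
        then have "cmod (cinner x (e k)) \<le> 1"
          using norm_cinner_le[of x "e k"] x by simp
        then have "\<bar>s k\<bar> * cmod (cinner x (e k)) \<le> s 0 * 1"
          using abs_s_le s_pos[rule_format, of 0] by (intro mult_mono) auto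
        then show ?thesis by (simp add: c_def norm_mult)
      qed
      then have "(\<Sum>k<N. c k *\<^sub>C e k) \<in> ?K" by blast
      then obtain z where z: "z \<in> F" "dist z (\<Sum>k<N. c k *\<^sub>C e k) < \<epsilon> / 4"
        using F(2) by auto
      have "norm (?D x - (\<Sum>k<N. c k *\<^sub>C e k)) \<le> \<epsilon> / 4 * norm x"
        unfolding c_def
      proof (rule norm_diag_op_tail[OF e abs_s_le])
        show "\<bar>s k\<bar> \<le> \<epsilon> / 4" if "k \<ge> N" for k
          using N decseqD[OF s_dec that] s_pos[rule_format, of k] by simp
      qed (use \<open>0 < \<epsilon>\<close> in auto)
      also have "\<dots> \<le> \<epsilon> / 4"
        using x \<open>0 < \<epsilon>\<close> by (simp add: mult_left_le)
      finally have "dist (\<Sum>k<N. c k *\<^sub>C e k) y \<le> \<epsilon> / 4"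
        using x by (simp add: dist_norm norm_minus_commute)
      then have "dist z y \<le> \<epsilon> / 2"
        using z dist_triangle[of z y "\<Sum>k<N. c k *\<^sub>C e k"] by simp
      then show "y \<in> (\<Union>x\<in>F. cball x (\<epsilon> / 2))" using z by auto
    qed
    moreover have "closed (\<Union>x\<in>F. cball x (\<epsilon> / 2))"
      using F(1) by auto
    ultimately have "closure (?D ` cball 0 1) \<subseteq> (\<Union>x\<in>F. cball x (\<epsilon> / 2))"
      by (rule closure_minimal)
    also have "\<dots> \<subseteq> (\<Union>x\<in>F. ball x \<epsilon>)"
      using \<open>0 < \<epsilon>\<close> by force
    finally show ?thesis using F(1) by blast
  qed
  then show "compact (closure (?D ` cball 0 1))"
    unfolding compact_eq_totally_bounded complete_eq_closed by auto
qed

lemma adjoint_diag_op: "adjoint_op (diag_op e s) = diag_op e s"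
  by (rule adjoint_op_eqI)
    (auto simp: bounded_op_diag_op[OF e abs_s_le] cinner_diag_op_commute[OF e abs_s_le])

text \<open>A positive square root \<open>S\<close> of \<open>D\<^sup>2\<close> acts like \<open>D\<close> on every member of the sequence and kills
  the orthogonal complement of their closed span. Splitting \<open>x\<close> with the orthogonal projection
  \<open>P\<close>, which is the diagonal operator with coefficients \<open>1\<close>, gives \<open>S x = D x\<close> by continuity.\<close>

lemma abs_diag_op: "abs_op (diag_op e s) = diag_op e s"
  unfolding abs_op_def adjoint_diag_op
proof (rule the_equality)
  let ?D = "diag_op e s"
  show "positive_op ?D \<and> ?D \<circ> ?D = ?D \<circ> ?D"
    using positive_diag_op[OF e abs_s_le] s_pos by (simp add: less_imp_le)
  fix S assume S: "positive_op S \<and> S \<circ> S = ?D \<circ> ?D"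
  then have SS: "S (S x) = ?D (?D x)" for x by (metis comp_apply)
  have bl: "bounded_linear S"
    using S by (simp add: positive_op_def bounded_op_def)
  have Se: "S (e k) = complex_of_real (s k) *\<^sub>C e k" for k
  proof (rule positive_sqrt_eigenvector)
    show "S (S (e k)) = complex_of_real ((s k)\<^sup>2) *\<^sub>C e k"
      by (simp add: SS diag_op_basis[OF e abs_s_le] diag_op_scaleC[OF e abs_s_le] scaleC_scaleC
          power2_eq_square)
  qed (use S s_pos[rule_format, of k] in auto)
  show "S = ?D"
  proof
    fix x
    have one: "\<forall>k::nat. \<bar>(\<lambda>_. 1) k\<bar> \<le> (1::real)" by simp
    define P where "P = diag_op e (\<lambda>_. 1)"
    have ortho: "cinner (x - P x) (e k) = 0" for k
      by (simp add: P_def cinner_simps cinner_diag_op_basis[OF e one])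
    have "?D (x - P x) = 0"
      by (rule diag_op_eqI[OF e abs_s_le]) (simp add: ortho)
    moreover have "?D 0 = 0"
      by (rule diag_op_eqI[OF e abs_s_le]) (simp add: cinner_simps)
    ultimately have "S (S (x - P x)) = complex_of_real (0\<^sup>2) *\<^sub>C (x - P x)"
      by (simp add: SS)
    then have "S (x - P x) = 0"
      using positive_sqrt_eigenvector[of S "x - P x" 0] S by simp
    then have "S x = S (P x)"
      using linear_diff[OF bounded_linear.linear[OF bl]] by simp
    moreover have "(\<lambda>k. S ((complex_of_real 1 * cinner x (e k)) *\<^sub>C e k)) sums S (P x)"
      unfolding P_def by (intro bounded_linear.sums[OF bl] diag_op_sums[OF e one])
    moreover have "S (c *\<^sub>C e k) = (complex_of_real (s k) * c) *\<^sub>C e k" for c k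
      using S by (simp add: positive_op_def bounded_op_def Se scaleC_scaleC mult.commute)
    ultimately have "(\<lambda>k. (complex_of_real (s k) * cinner x (e k)) *\<^sub>C e k) sums S x"
      by simp
    then show "S x = ?D x"
      by (rule diag_op_eqI[OF e abs_s_le, symmetric])
  qed
qed

lemma finite_fibre: "0 < l \<Longrightarrow> finite {k. s k = l}"
proof -
  assume "0 < l"
  with s_lim have "eventually (\<lambda>k. s k < l) sequentially"
    by (rule order_tendstoD)
  then obtain N where N: "\<And>k. k \<ge> N \<Longrightarrow> s k < l" by (auto simp: eventually_sequentially)
  have "{k. s k = l} \<subseteq> {..<N}"
    using N by (force simp: not_less[symmetric])
  then show ?thesis using finite_subset by blast
qed

lemma cdim_eigenspace_diag_op:
  assumes l: "0 < l"
  shows "cdim (eigenspace (diag_op e s) l) = card {k. s k = l}"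
proof -
  let ?B = "e ` {k. s k = l}"
  have inj: "inj e"
    using e unfolding orthonormal_seq_def inj_def by (metis zero_neq_one)
  have "cdim (eigenspace (diag_op e s) l) = card ?B"
  proof (rule complex_space.dim_unique[of ?B, OF _ _ _ refl])
    show "?B \<subseteq> eigenspace (diag_op e s) l"
      by (auto simp: eigenspace_def diag_op_basis[OF e abs_s_le] scaleC_of_real)
    show "\<not> complex_space.dependent ?B"
    proof
      assume "complex_space.dependent ?B"
      then obtain u v where uv: "(\<Sum>w\<in>?B. u w *\<^sub>C w) = 0" "v \<in> ?B" "u v \<noteq> 0"
        using finite_fibre[OF l] by (auto simp: complex_space.dependent_finite)
      have "cinner (\<Sum>w\<in>?B. u w *\<^sub>C w) v = (\<Sum>w\<in>?B. if w = v then u v else 0)"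
        unfolding cinner_simps
      proof (rule sum.cong[OF refl])
        fix w assume "w \<in> ?B"
        with uv(2) obtain i j where "w = e i" "v = e j" by blast
        then show "u w * cinner w v = (if w = v then u v else 0)"
          by (simp add: cinner_orthonormal[OF e] inj_eq[OF inj])
      qed
      then show False
        using uv finite_fibre[OF l] by (simp add: cinner_simps)
    qed
    show "eigenspace (diag_op e s) l \<subseteq> cspan ?B"
    proof
      fix x assume "x \<in> eigenspace (diag_op e s) l"
      then have x: "diag_op e s x = complex_of_real l *\<^sub>C x"
        by (simp add: eigenspace_def scaleC_of_real)
      have zero: "cinner x (e k) = 0" if "s k \<noteq> l" for k
        using cinner_diag_op_basis[OF e abs_s_le, of x k] that unfolding x
        by (simp add: cinner_simps)
      have "diag_op e s x = (\<Sum>k\<in>{k. s k = l}. (complex_of_real (s k) * cinner x (e k)) *\<^sub>C e k)"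
        by (rule diag_op_eqI[OF e abs_s_le], rule sums_finite[OF finite_fibre[OF l]]) (simp add: zero)
      also have "\<dots> \<in> cspan ?B"
        by (intro complex_space.span_sum complex_space.span_scale complex_space.span_base) auto
      finally have "complex_of_real (1 / l) *\<^sub>C complex_of_real l *\<^sub>C x \<in> cspan ?B"
        unfolding x by (rule complex_space.span_scale)
      then show "x \<in> cspan ?B"
        using l by (simp add: scaleC_scaleC)
    qed
  qed
  also have "\<dots> = card {k. s k = l}"
    using inj by (intro card_image) (auto simp: inj_on_def inj_def)
  finally show ?thesis .
qed

end


section \<open>Singular values and traces\<close>

text \<open>At the first index \<open>n\<close> where two eigenvalue sequences differ, the larger value \<open>l\<close> is
  positive and is taken by the smaller sequence only before \<open>n\<close>, where the sequences agree. So it is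
  taken more often by the other one, contradicting that both count the multiplicity of \<open>l\<close>.\<close>

lemma eigenvalue_sequence_unique:
  assumes "eigenvalue_sequence A s" "eigenvalue_sequence A t"
  shows "s = t"
proof (rule ccontr)
  have no_first_difference: False
    if s: "eigenvalue_sequence A s" and t: "eigenvalue_sequence A t"
      and less: "t n < s n" and eq: "\<And>i. i < n \<Longrightarrow> s i = t i" for s t n
  proof -
    have pos: "0 < s n"
      using t less by (metis eigenvalue_sequence_def order_le_less_trans)
    have sub: "{i. t i = s n} \<subseteq> {i. s i = s n} - {n}"
    proof
      fix i assume i: "i \<in> {i. t i = s n}"
      have "i < n"
      proof (rule ccontr)
        assume "\<not> i < n"
        then have "t i \<le> t n"
          using t decseqD[of t n i] by (simp add: eigenvalue_sequence_def)
        then show False using i less by simp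
      qed
      then show "i \<in> {i. s i = s n} - {n}" using i eq by auto
    qed
    have fin: "finite {i. s i = s n}"
      using s pos by (auto simp: eigenvalue_sequence_def)
    have "card {i. t i = s n} < card {i. s i = s n}"
      by (rule psubset_card_mono[OF fin]) (use sub in auto)
    moreover have "card {i. t i = s n} = card {i. s i = s n}"
      using s t pos by (auto simp: eigenvalue_sequence_def)
    ultimately show False by simp
  qed
  assume "s \<noteq> t"
  then obtain m where "s m \<noteq> t m" by auto
  then obtain n where n: "s n \<noteq> t n" "\<And>i. i < n \<Longrightarrow> s i = t i"
    using exists_least_iff[of "\<lambda>n. s n \<noteq> t n"] by auto
  then consider "t n < s n" | "s n < t n" by linarith
  then show False
  proof cases
    case 1
    then show False using no_first_difference[OF assms] n by auto
  next
    case 2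
    then show False using no_first_difference[OF assms(2,1)] n by (metis)
  qed
qed

lemma singular_value_eqI:
  assumes "eigenvalue_sequence (abs_op T) s"
  shows "singular_value k T = s k"
  unfolding singular_value_def
  using the_equality[of "eigenvalue_sequence (abs_op T)" s] assms eigenvalue_sequence_unique by metis

lemma singular_value_diag_op:
  assumes "orthonormal_seq e" "decseq s" "s \<longlonglongrightarrow> 0" "\<forall>k. 0 < s k"
  shows "singular_value k (diag_op e s) = s k"
proof (rule singular_value_eqI)
  show "eigenvalue_sequence (abs_op (diag_op e s)) s"
    unfolding abs_diag_op[OF assms] eigenvalue_sequence_def
    using assms finite_fibre[OF assms] cdim_eigenspace_diag_op[OF assms]
    by (auto simp: less_imp_le)
qed

lemma bounded_op_zero: "bounded_op (\<lambda>x::'h::complex_inner. 0)"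
  by (simp add: bounded_op_def)

lemma adjoint_zero: "adjoint_op (\<lambda>x::'h::complex_inner. 0) = (\<lambda>x. 0)"
  by (rule adjoint_op_eqI) (auto simp: bounded_op_zero cinner_simps)

lemma abs_zero_op: "abs_op (\<lambda>x::'h::complex_inner. 0) = (\<lambda>x. 0)"
  unfolding abs_op_def adjoint_zero
proof (rule the_equality)
  show "positive_op (\<lambda>x::'h. 0) \<and> (\<lambda>x::'h. 0) \<circ> (\<lambda>x. 0) = (\<lambda>x. 0) \<circ> (\<lambda>x::'h. 0)"
    by (simp add: positive_op_def bounded_op_zero cinner_simps)
  fix S :: "'h \<Rightarrow> 'h"
  assume S: "positive_op S \<and> S \<circ> S = (\<lambda>x. 0) \<circ> (\<lambda>x. 0)"
  then have "S (S x) = complex_of_real (0\<^sup>2) *\<^sub>C x" for x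
    by (auto simp: fun_eq_iff)
  then show "S = (\<lambda>x. 0)"
    using positive_sqrt_eigenvector[of S _ 0] S by auto
qed

lemma singular_value_zero: "singular_value k (\<lambda>x::'h::complex_inner. 0) = 0"
proof (rule singular_value_eqI)
  have "cdim {x::'h. x = 0} = 0"
    by (rule complex_space.dim_unique[of "{}"]) (auto simp: complex_space.independent_empty)
  moreover have "eigenspace (\<lambda>x::'h. 0) l = {x. x = 0}" if "l > 0" for l
    using that by (auto simp: eigenspace_def)
  ultimately show "eigenvalue_sequence (abs_op (\<lambda>x::'h. 0)) (\<lambda>_. 0)"
    unfolding abs_zero_op eigenvalue_sequence_def by (auto simp: decseq_def)
qed

text \<open>The weight of the zero operator has to stay in the formula, since \<open>\<omega>\<close> is arbitrary here: the
  negative part of the real part and both parts of the imaginary part are zero.\<close>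

lemma dixmier_trace_positive:
  fixes T :: "'h::complex_inner \<Rightarrow> 'h"
  assumes "adjoint_op T = T" "abs_op T = T"
  shows "dixmier_trace \<psi> \<omega> T =
    complex_of_real (dixmier_weight \<psi> \<omega> T - dixmier_weight \<psi> \<omega> (\<lambda>x::'h. 0))"
proof -
  have half: "(1 / 2) *\<^sub>C (x + x) = x" for x :: 'h
    by (simp add: scaleC_add_right flip: scaleC_add_left)
  have "real_part_op T = T" "imag_part_op T = (\<lambda>x. 0)"
    by (simp_all add: fun_eq_iff real_part_op_def imag_part_op_def assms half)
  moreover have "pos_part_op T = T" "neg_part_op T = (\<lambda>x. 0)"
    by (simp_all add: fun_eq_iff pos_part_op_def neg_part_op_def assms half)
  moreover have "pos_part_op (\<lambda>x::'h. 0) = (\<lambda>x. 0)" "neg_part_op (\<lambda>x::'h. 0) = (\<lambda>x. 0)"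
    by (simp_all add: fun_eq_iff pos_part_op_def neg_part_op_def abs_zero_op)
  ultimately show ?thesis
    by (simp add: dixmier_trace_def complex_eq_iff)
qed


section \<open>Logarithmic means of step functions\<close>

lemma step_fun_eq:
  assumes "0 < t"
  shows "step_fun x t = x (nat \<lceil>t\<rceil> - 1)"
proof -
  define m where "m = nat \<lceil>t\<rceil> - 1"
  have ind: "t \<in> {real n<..real n + 1} \<longleftrightarrow> n = m" for n
  proof -
    have "t \<in> {real n<..real n + 1} \<longleftrightarrow> \<lceil>t\<rceil> = int n + 1"
      unfolding ceiling_eq_iff by auto
    also have "\<dots> \<longleftrightarrow> n = m"
      using assms unfolding m_def by linarith
    finally show ?thesis .
  qed
  have "(\<lambda>n. x n * indicator {real n<..real n + 1} t) = (\<lambda>n. if n = m then x n else 0)"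
    by (auto simp: fun_eq_iff indicator_def ind simp del: greaterThanAtMost_iff)
  then have "step_fun x t = (\<Sum>n. if n = m then x n else 0)"
    unfolding step_fun_def by simp
  also have "\<dots> = x m"
    using sums_single[of m x] by (simp add: sums_iff)
  finally show ?thesis unfolding m_def .
qed

lemma step_fun_measurable [measurable]: "step_fun x \<in> borel_measurable borel"
  unfolding step_fun_def by measurable

text \<open>Both orientations of the integral are kept, because a function in \<open>L_infinity\<close> lives on all of
  \<open>(0,\<infinity>)\<close>. Over Lebesgue-Borel measure with the bounds written as conditions on \<open>s\<close>, the
  measurability of \<open>log_mean\<close> becomes that of a parametric integral.\<close>

lemma log_mean_step_fun:
  "log_mean (step_fun x) t = 1 / ln t *
     (if 1 \<le> t then \<integral>s. (if 1 < s \<and> s < t then step_fun x s / s else 0) \<partial>lborel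
      else - (\<integral>s. (if t < s \<and> s < 1 then step_fun x s / s else 0) \<partial>lborel))"
proof -
  have "(\<integral>s. indicator (einterval (ereal a) (ereal b)) s *\<^sub>R (step_fun x s / s) \<partial>lebesgue)
      = (\<integral>s. (if a < s \<and> s < b then step_fun x s / s else 0) \<partial>lborel)" for a b
  proof -
    have "(\<integral>s. indicator (einterval (ereal a) (ereal b)) s *\<^sub>R (step_fun x s / s) \<partial>lebesgue)
      = (\<integral>s. (if a < s \<and> s < b then step_fun x s / s else 0) \<partial>lebesgue)"
      by (intro Bochner_Integration.integral_cong) (auto simp: indicator_def)
    also have "\<dots> = (\<integral>s. (if a < s \<and> s < b then step_fun x s / s else 0) \<partial>lborel)"
      by (intro integral_completion) measurable
    finally show ?thesis .
  qed
  then show ?thesis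
    unfolding log_mean_def interval_lebesgue_integral_def set_lebesgue_integral_def by simp
qed

lemma log_mean_step_fun_measurable [measurable]: "log_mean (step_fun x) \<in> borel_measurable borel"
  unfolding log_mean_step_fun[abs_def] by measurable

lemma has_bochner_integral_inverse:
  fixes a b :: real
  assumes "0 < a" "a \<le> b"
  shows "has_bochner_integral lborel (\<lambda>s. 1 / s * indicator {a..b} s) (ln b - ln a)"
  by (rule has_bochner_integral_FTC_Icc_nonneg) (use assms in \<open>auto intro!: derivative_eq_intros\<close>)

lemma integral_dominated_inverse:
  fixes f :: "real \<Rightarrow> real"
  assumes [measurable]: "f \<in> borel_measurable borel"
    and Q: "finite Q" "\<And>m. m \<in> Q \<Longrightarrow> 0 < a m \<and> a m \<le> b m"
    and dom: "\<And>s. \<bar>f s\<bar> \<le> (\<Sum>m\<in>Q. C * (1 / s * indicator {a m..b m} s))"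
  shows "integrable lborel f \<and> \<bar>\<integral>s. f s \<partial>lborel\<bar> \<le> C * (\<Sum>m\<in>Q. ln (b m) - ln (a m))"
proof -
  have h: "has_bochner_integral lborel (\<lambda>s. \<Sum>m\<in>Q. C * (1 / s * indicator {a m..b m} s))
      (\<Sum>m\<in>Q. C * (ln (b m) - ln (a m)))"
    using Q by (intro has_bochner_integral_sum has_bochner_integral_mult_right has_bochner_integral_inverse) auto
  have "integrable lborel (\<lambda>s. \<Sum>m\<in>Q. C * (1 / s * indicator {a m..b m} s))"
    using h by (simp only: has_bochner_integral_iff)
  then have f: "integrable lborel f"
  proof (rule Bochner_Integration.integrable_bound)
    show "AE s in lborel. norm (f s) \<le> norm (\<Sum>m\<in>Q. C * (1 / s * indicator {a m..b m} s))"
      unfolding real_norm_def by (intro AE_I2 order_trans[OF dom abs_ge_self])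
  qed simp
  have "\<bar>\<integral>s. f s \<partial>lborel\<bar> \<le> (\<integral>s. \<bar>f s\<bar> \<partial>lborel)"
    by (rule integral_abs_bound)
  also have "\<dots> \<le> (\<integral>s. (\<Sum>m\<in>Q. C * (1 / s * indicator {a m..b m} s)) \<partial>lborel)"
    using f h dom by (intro integral_mono) (auto simp: has_bochner_integral_iff)
  also have "\<dots> = C * (\<Sum>m\<in>Q. ln (b m) - ln (a m))"
    using h by (simp only: has_bochner_integral_iff sum_distrib_left)
  finally show ?thesis using f by blast
qed

lemma interval_inverse_bound:
  fixes f :: "real \<Rightarrow> real"
  assumes [measurable]: "f \<in> borel_measurable borel" and "0 < a" "a \<le> b" and C: "\<And>s. 0 < s \<Longrightarrow> \<bar>f s\<bar> \<le> C"
  shows "integrable lborel (\<lambda>s. if a < s \<and> s < b then f s / s else 0)"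
    and "\<bar>\<integral>s. (if a < s \<and> s < b then f s / s else 0) \<partial>lborel\<bar> \<le> C * (ln b - ln a)"
proof -
  have "0 \<le> C" using C[of 1] by simp
  have "\<bar>if a < s \<and> s < b then f s / s else 0\<bar> \<le> (\<Sum>m\<in>{()}. C * (1 / s * indicator {a..b} s))" for s
    using C[of s] \<open>0 < a\<close> \<open>0 \<le> C\<close> by (auto simp: indicator_def divide_right_mono)
  from integral_dominated_inverse[OF _ _ _ this] assms
  show "integrable lborel (\<lambda>s. if a < s \<and> s < b then f s / s else 0)"
    and "\<bar>\<integral>s. (if a < s \<and> s < b then f s / s else 0) \<partial>lborel\<bar> \<le> C * (ln b - ln a)"
    by auto
qed

lemma log_mean_step_fun_bounded:
  assumes C: "\<And>n. \<bar>x n\<bar> \<le> C" and "0 < t"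
  shows "\<bar>log_mean (step_fun x) t\<bar> \<le> C"
proof -
  have C': "\<bar>step_fun x s\<bar> \<le> C" if "0 < s" for s
    using C that by (simp add: step_fun_eq)
  have "0 \<le> C" using C[of 0] by simp
  consider "t = 1" | "1 < t" | "t < 1" by linarith
  then show ?thesis
  proof cases
    \<comment> \<open>Here the factor \<open>1 / ln t\<close> is a division by zero, so the mean is \<open>0\<close>.\<close>
    case 1
    then show ?thesis using \<open>0 \<le> C\<close> by (simp add: log_mean_def)
  next
    case 2
    then show ?thesis
      using interval_inverse_bound(2)[of "step_fun x" 1 t C] C'
      by (simp add: log_mean_step_fun abs_mult divide_le_eq)
  next
    case 3
    define I where "I = (\<integral>s. (if t < s \<and> s < 1 then step_fun x s / s else 0) \<partial>lborel)"
    have "\<bar>I\<bar> \<le> C * \<bar>ln t\<bar>"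
      using interval_inverse_bound(2)[of "step_fun x" t 1 C] C' \<open>0 < t\<close> 3
      by (simp add: I_def)
    moreover have "0 < \<bar>ln t\<bar>" using 3 \<open>0 < t\<close> by simp
    moreover have "\<bar>log_mean (step_fun x) t\<bar> = \<bar>I\<bar> / \<bar>ln t\<bar>"
      using 3 by (simp add: log_mean_step_fun I_def abs_mult)
    ultimately show ?thesis by (simp only: pos_divide_le_eq)
  qed
qed

lemma log_mean_step_fun_L_infinity:
  assumes "\<And>n. \<bar>x n\<bar> \<le> C"
  shows "log_mean (step_fun x) \<in> L_infinity"
  unfolding L_infinity_def
proof (intro CollectI conjI exI)
  have "log_mean (step_fun x) \<in> borel_measurable lebesgue"
    by (intro measurable_completion) simp
  then show "log_mean (step_fun x) \<in> borel_measurable (lebesgue_on {0<..})"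
    by (rule measurable_restrict_space1)
  show "AE t in lebesgue_on {0<..}. \<bar>log_mean (step_fun x) t\<bar> \<le> C"
    by (rule AE_I2) (use log_mean_step_fun_bounded[OF assms] in \<open>auto simp: space_restrict_space\<close>)
qed

text \<open>What the logarithmic mean can notice: if \<open>x\<close> equals \<open>l\<close> outside some integer intervals, then
  only the total logarithmic length of these intervals counts.\<close>

lemma log_mean_deviation_bound:
  fixes a b :: "'i \<Rightarrow> nat"
  assumes t: "1 < t" and C: "\<And>n. \<bar>x n - l\<bar> \<le> C"
    and Q: "finite Q" "\<And>m. m \<in> Q \<Longrightarrow> 0 < a m \<and> a m \<le> b m"
    and exc: "\<And>n. real n < t \<Longrightarrow> x n \<noteq> l \<Longrightarrow> \<exists>m\<in>Q. a m \<le> n \<and> n < b m"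
  shows "\<bar>log_mean (step_fun x) t - l\<bar> \<le> C * (\<Sum>m\<in>Q. ln (b m) - ln (a m)) / ln t"
proof -
  let ?I = "\<lambda>f. \<integral>s. (if 1 < s \<and> s < t then f s / s else 0) \<partial>lborel"
  have "0 \<le> C" using C[of 0] by simp
  define y where "y n = x n - l" for n
  have y: "step_fun x s = l + step_fun y s" if "0 < s" for s
    using that by (simp add: step_fun_eq y_def)
  have "\<bar>if 1 < s \<and> s < t then step_fun y s / s else 0\<bar>
      \<le> (\<Sum>m\<in>Q. C * (1 / s * indicator {real (a m)..real (b m)} s))" for s
  proof (cases "1 < s \<and> s < t \<and> step_fun y s \<noteq> 0")
    case True
    define n where "n = nat \<lceil>s\<rceil> - 1"
    have n: "real n < s" "s \<le> real n + 1"
      using True unfolding n_def by linarith+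
    have sy: "step_fun y s = y n" using True by (simp add: step_fun_eq n_def)
    then have "x n \<noteq> l" using True by (simp add: y_def)
    with exc[of n] n True obtain m where m: "m \<in> Q" "a m \<le> n" "n < b m" by force
    have "\<bar>step_fun y s / s\<bar> \<le> C * (1 / s * indicator {real (a m)..real (b m)} s)"
      using m n True C[of n] by (simp add: sy y_def indicator_def divide_right_mono)
    also have "\<dots> \<le> (\<Sum>m\<in>Q. C * (1 / s * indicator {real (a m)..real (b m)} s))"
      using \<open>0 \<le> C\<close> True m Q by (intro member_le_sum) auto
    finally show ?thesis using True by simp
  next
    case False
    have "0 \<le> C * (1 / s * indicator {real (a m)..real (b m)} s)" if "m \<in> Q" for m
    proof (cases "s \<in> {real (a m)..real (b m)}")
      case True
      moreover have "0 < real (a m)" using Q that by auto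
      ultimately have "0 < s" by auto
      then show ?thesis using \<open>0 \<le> C\<close> by simp
    qed simp
    then show ?thesis using False by (auto intro: sum_nonneg)
  qed
  from integral_dominated_inverse[OF _ Q(1) _ this] Q
  have bound: "\<bar>?I (step_fun y)\<bar> \<le> C * (\<Sum>m\<in>Q. ln (b m) - ln (a m))"
    by auto
  have one: "has_bochner_integral lborel (\<lambda>s. if 1 < s \<and> s < t then 1 / s else 0) (ln t)"
  proof (rule has_bochner_integralI_AE)
    show "has_bochner_integral lborel (\<lambda>s. 1 / s * indicator {1..t} s) (ln t)"
      using has_bochner_integral_inverse[of 1 t] t by simp
    show "AE s in lborel. 1 / s * indicator {1..t} s = (if 1 < s \<and> s < t then 1 / s else 0)"
      using AE_lborel_singleton[of 1] AE_lborel_singleton[of t]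
      by eventually_elim (auto simp: indicator_def)
  qed measurable
  have "?I (step_fun x) = (\<integral>s. l * (if 1 < s \<and> s < t then 1 / s else 0)
      + (if 1 < s \<and> s < t then step_fun y s / s else 0) \<partial>lborel)"
    by (intro Bochner_Integration.integral_cong) (auto simp: y add_divide_distrib)
  also have "\<dots> = l * ln t + ?I (step_fun y)"
  proof (subst Bochner_Integration.integral_add)
    show "integrable lborel (\<lambda>s. if 1 < s \<and> s < t then step_fun y s / s else 0)"
      by (rule interval_inverse_bound(1)[where C = C]) (use t C in \<open>auto simp: step_fun_eq y_def\<close>)
  qed (use one in \<open>auto simp: has_bochner_integral_iff\<close>)
  finally have "log_mean (step_fun x) t - l = ?I (step_fun y) / ln t"
    using t by (simp add: log_mean_step_fun field_simps)
  then show ?thesis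
    using bound t by (simp add: divide_right_mono)
qed


section \<open>Flattening the growth function on a sparse family of blocks\<close>

definition sqrt_log_growth :: "real \<Rightarrow> real" where
  "sqrt_log_growth t = 2 powr sqrt (log 2 (1 + t)) - 1"

text \<open>The shift by one matches the \<open>1 + t\<close> in the growth function, whose values at the knots
  are therefore exactly \<open>2 ^ m - 1\<close>.\<close>

definition knot :: "nat \<Rightarrow> nat" where
  "knot m = 2 ^ (m\<^sup>2) - 1"

text \<open>The indices of the blocks on which the growth function is replaced by its chord. Powers of two
  start at \<open>1\<close>, so the first such block starts at the positive knot \<open>1\<close>, which keeps its logarithmic
  length finite.\<close>

abbreviation sparse :: "nat set" where
  "sparse \<equiv> range (\<lambda>j. 2 ^ j)"

lemma Suc_knot: "Suc (knot m) = 2 ^ (m\<^sup>2)"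
  by (simp add: knot_def)

lemma one_plus_knot: "1 + real (knot m) = 2 ^ (m\<^sup>2)"
  using arg_cong[OF Suc_knot[of m], of real] by simp

lemma growth_knot: "sqrt_log_growth (knot m) = 2 ^ m - 1"
proof -
  have "log 2 (2 ^ (m\<^sup>2)) = (real m)\<^sup>2"
    by (simp add: log_nat_power)
  then show ?thesis
    unfolding sqrt_log_growth_def one_plus_knot by (simp add: powr_realpow)
qed

lemma growth_mono: "0 \<le> s \<Longrightarrow> s \<le> t \<Longrightarrow> sqrt_log_growth s \<le> sqrt_log_growth t"
  unfolding sqrt_log_growth_def by (intro diff_right_mono powr_mono real_sqrt_le_mono) auto

lemma strict_mono_knot: "strict_mono knot"
proof (rule strict_monoI)
  fix m n :: nat assume "m < n"
  then have "m\<^sup>2 < n\<^sup>2" by (simp add: power_strict_mono)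
  then have "(2::nat) ^ (m\<^sup>2) < 2 ^ (n\<^sup>2)" by simp
  then show "knot m < knot n" using Suc_knot[of m] Suc_knot[of n] by linarith
qed

lemma knot_ge: "m \<le> knot m"
  using strict_mono_imp_increasing[OF strict_mono_knot] .

lemma DERIV_growth:
  assumes "0 < t"
  defines "u \<equiv> sqrt (log 2 (1 + t))"
  shows "(sqrt_log_growth has_real_derivative 2 powr (u - u\<^sup>2) / (2 * u)) (at t)"
proof -
  have pos: "0 < log 2 (1 + t)" using assms by simp
  have t: "1 + t = 2 powr (u\<^sup>2)" using assms pos by (simp add: u_def)
  have "((\<lambda>t. log 2 (1 + t)) has_real_derivative 1 / ((1 + t) * ln 2)) (at t)"
    using assms by (auto intro!: derivative_eq_intros)
  from DERIV_chain2[OF DERIV_real_sqrt[OF pos] this]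
  have inner: "((\<lambda>t. sqrt (log 2 (1 + t))) has_real_derivative inverse u / 2 * (1 / ((1 + t) * ln 2))) (at t)"
    unfolding u_def .
  have "((\<lambda>v. 2 powr v - 1) has_real_derivative 2 powr u * ln 2) (at u)"
    by (auto intro!: derivative_eq_intros)
  from DERIV_chain2[OF this[unfolded u_def] inner]
  have "(sqrt_log_growth has_real_derivative
      2 powr u * ln 2 * (inverse u / 2 * (1 / ((1 + t) * ln 2)))) (at t)"
    unfolding sqrt_log_growth_def[abs_def] u_def .
  also have "2 powr u * ln 2 * (inverse u / 2 * (1 / ((1 + t) * ln 2))) = 2 powr (u - u\<^sup>2) / (2 * u)"
    unfolding t by (simp add: powr_diff field_simps)
  finally show ?thesis .
qed

definition growth_incr :: "nat \<Rightarrow> real" where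
  "growth_incr k = sqrt_log_growth (real k + 1) - sqrt_log_growth (real k)"

lemma sum_growth_incr: "a \<le> b \<Longrightarrow> (\<Sum>k=a..<b. growth_incr k) = sqrt_log_growth b - sqrt_log_growth a"
  unfolding growth_incr_def using sum_Suc_diff'[of a b "\<lambda>k. sqrt_log_growth (real k)"]
  by (simp add: add.commute)

lemma growth_incr_pos: "0 < growth_incr k"
proof -
  have "sqrt (log 2 (1 + real k)) < sqrt (log 2 (1 + (real k + 1)))"
    by (intro real_sqrt_less_mono) simp
  then show ?thesis unfolding growth_incr_def sqrt_log_growth_def by simp
qed

text \<open>This is the concavity of the growth function at the integers. With \<open>u = sqrt (log 2 (1 + t))\<close>
  the derivative is \<open>2 powr (u - u\<^sup>2) / (2 * u)\<close>, which visibly decreases once \<open>u \<ge> 1\<close>, that is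
  \<open>t \<ge> 1\<close>. The first two increments are compared by hand, as \<open>sqrt (log 2 3) \<le> log 2 3\<close>.\<close>

lemma growth_incr_antimono: "decseq growth_incr"
proof (rule decseq_SucI)
  fix k :: nat
  show "growth_incr (Suc k) \<le> growth_incr k"
  proof (cases "k = 0")
    case True
    have "1 \<le> log 2 (3::real)" by simp
    then have "(log 2 (3::real)) \<le> (log 2 3)\<^sup>2" by (simp add: power2_eq_square)
    then have "sqrt (log 2 3) \<le> log 2 (3::real)" using \<open>1 \<le> log 2 3\<close> by (intro real_le_lsqrt) auto
    then have "2 powr sqrt (log 2 3) \<le> (2::real) powr log 2 3" by (rule powr_mono) simp
    also have "\<dots> = 3" by simp
    finally show ?thesis using True by (simp add: growth_incr_def sqrt_log_growth_def)
  next
    case False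
    have ex: "\<exists>z>real n. z < real n + 1 \<and> growth_incr n
        = 2 powr (sqrt (log 2 (1 + z)) - (sqrt (log 2 (1 + z)))\<^sup>2) / (2 * sqrt (log 2 (1 + z)))"
      if "0 < n" for n
      using MVT2[of "real n" "real n + 1" sqrt_log_growth, OF _ DERIV_growth] that
      unfolding growth_incr_def by force
    obtain y where y: "real k < y" "y < real k + 1" "growth_incr k
        = 2 powr (sqrt (log 2 (1 + y)) - (sqrt (log 2 (1 + y)))\<^sup>2) / (2 * sqrt (log 2 (1 + y)))"
      using ex[of k] False by blast
    obtain z where z: "real (Suc k) < z" "growth_incr (Suc k)
        = 2 powr (sqrt (log 2 (1 + z)) - (sqrt (log 2 (1 + z)))\<^sup>2) / (2 * sqrt (log 2 (1 + z)))"
      using ex[of "Suc k"] by blast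
    define u v where "u = sqrt (log 2 (1 + y))" and "v = sqrt (log 2 (1 + z))"
    have "1 \<le> u" using y False by (simp add: u_def)
    have "u \<le> v" unfolding u_def v_def using y z False by simp
    have "0 \<le> (v - u) * (u + v - 1)"
      using \<open>1 \<le> u\<close> \<open>u \<le> v\<close> by (intro mult_nonneg_nonneg) auto
    then have "v - v\<^sup>2 \<le> u - u\<^sup>2"
      by (simp add: power2_eq_square algebra_simps)
    then have "2 powr (v - v\<^sup>2) / (2 * v) \<le> 2 powr (u - u\<^sup>2) / (2 * u)"
      using \<open>1 \<le> u\<close> \<open>u \<le> v\<close> by (intro frac_le) auto
    then show ?thesis using y z by (simp add: u_def v_def)
  qed
qed

definition block :: "nat \<Rightarrow> nat" where
  "block k = (LEAST m. k < knot (Suc m))"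

lemma block_bounds: "knot (block k) \<le> k" "k < knot (Suc (block k))"
proof -
  have "k < knot (Suc k)"
    using strict_mono_imp_increasing[OF strict_mono_knot, of "Suc k"] by simp
  then show *: "k < knot (Suc (block k))"
    unfolding block_def by (rule LeastI)
  show "knot (block k) \<le> k"
  proof (cases "block k")
    case 0
    then show ?thesis by (simp add: knot_def)
  next
    case (Suc m)
    then have "\<not> k < knot (Suc m)"
      using not_less_Least[of m "\<lambda>m. k < knot (Suc m)"] by (simp add: block_def)
    then show ?thesis using Suc by simp
  qed
qed

lemma block_eqI:
  assumes "knot m \<le> k" "k < knot (Suc m)"
  shows "block k = m"
proof -
  have "knot (block k) < knot (Suc m)" "knot m < knot (Suc (block k))"
    using assms block_bounds[of k] by linarith+
  then show ?thesis
    using strict_mono_less[OF strict_mono_knot] by auto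
qed

text \<open>The slope of the chord over the block \<open>m\<close>, the rise from \<open>2 ^ m - 1\<close> to
  \<open>2 ^ Suc m - 1\<close> being \<open>2 ^ m\<close>.\<close>

definition flat_incr :: "nat \<Rightarrow> real" where
  "flat_incr m = 2 ^ m / (real (knot (Suc m)) - real (knot m))"

definition flattened :: "nat \<Rightarrow> real" where
  "flattened k = (if block k \<in> sparse then flat_incr (block k) else growth_incr k)"

lemma knot_Suc_less: "knot m < knot (Suc m)"
  using strict_mono_knot by (simp add: strict_mono_less)

lemma flattened_pos: "0 < flattened k"
  using growth_incr_pos knot_Suc_less[of "block k"] by (simp add: flattened_def flat_incr_def)

lemma flattened_eq_flat:
  "knot m \<le> k \<Longrightarrow> k < knot (Suc m) \<Longrightarrow> m \<in> sparse \<Longrightarrow> flattened k = flat_incr m"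
  by (simp add: flattened_def block_eqI)

lemma flattened_eq_incr:
  "knot m \<le> k \<Longrightarrow> k < knot (Suc m) \<Longrightarrow> m \<notin> sparse \<Longrightarrow> flattened k = growth_incr k"
  by (simp add: flattened_def block_eqI)

lemma sum_block_growth: "(\<Sum>k=knot m..<knot (Suc m). growth_incr k) = 2 ^ m"
  using knot_Suc_less[of m] by (simp add: sum_growth_incr growth_knot)

lemma flat_incr_mult: "(real (knot (Suc m)) - real (knot m)) * flat_incr m = 2 ^ m"
  using knot_Suc_less[of m] by (simp add: flat_incr_def)

lemma flat_incr_between:
  shows "flat_incr m \<le> growth_incr (knot m)" "growth_incr (knot (Suc m) - 1) \<le> flat_incr m"
proof -
  have c: "real (card {knot m..<knot (Suc m)}) = real (knot (Suc m)) - real (knot m)"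
    using knot_Suc_less[of m] by (simp add: of_nat_diff)
  have pos: "0 < real (knot (Suc m)) - real (knot m)" using knot_Suc_less[of m] by simp
  have "(\<Sum>k=knot m..<knot (Suc m). growth_incr k) \<le> real (card {knot m..<knot (Suc m)}) * growth_incr (knot m)"
    by (rule sum_bounded_above) (use growth_incr_antimono in \<open>auto simp: decseq_def\<close>)
  then show "flat_incr m \<le> growth_incr (knot m)"
    using pos unfolding c sum_block_growth by (simp add: flat_incr_def divide_le_eq mult.commute)
  have "real (card {knot m..<knot (Suc m)}) * growth_incr (knot (Suc m) - 1) \<le> (\<Sum>k=knot m..<knot (Suc m). growth_incr k)"
    by (rule sum_bounded_below) (use growth_incr_antimono in \<open>auto simp: decseq_def\<close>)
  then show "growth_incr (knot (Suc m) - 1) \<le> flat_incr m"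
    using pos unfolding c sum_block_growth by (simp add: flat_incr_def le_divide_eq mult.commute)
qed

text \<open>Averaging a decreasing sequence over consecutive blocks keeps it decreasing, because each
  average lies between the last and the first entry of its block.\<close>

lemma flattened_antimono: "decseq flattened"
proof (rule decseq_SucI)
  fix k
  have dec: "growth_incr (Suc k) \<le> growth_incr k"
    using growth_incr_antimono by (simp add: decseq_def)
  define m where "m = block k"
  have m: "knot m \<le> k" "k < knot (Suc m)" using block_bounds unfolding m_def by auto
  show "flattened (Suc k) \<le> flattened k"
  proof (cases "Suc k < knot (Suc m)")
    case True
    then have "block (Suc k) = m" using m by (intro block_eqI) auto
    then show ?thesis using dec by (simp add: flattened_def m_def[symmetric])
  next
    case False
    then have k: "Suc k = knot (Suc m)" using m by simp
    have "block (Suc k) = Suc m" using k knot_Suc_less[of "Suc m"] by (intro block_eqI) auto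
    then have "flattened (Suc k) \<le> growth_incr (Suc k)"
      using flat_incr_between(1)[of "Suc m"] k by (simp add: flattened_def)
    also have "\<dots> \<le> growth_incr k" by (rule dec)
    also have "\<dots> \<le> flattened k"
      using flat_incr_between(2)[of m] k[symmetric] by (simp add: flattened_def m_def[symmetric])
    finally show ?thesis .
  qed
qed

definition flattened_sum :: "nat \<Rightarrow> real" where
  "flattened_sum N = (\<Sum>k<N. flattened k)"

lemma flattened_sum_split: "M \<le> N \<Longrightarrow> flattened_sum N = flattened_sum M + (\<Sum>k=M..<N. flattened k)"
  unfolding flattened_sum_def lessThan_atLeast0 by (simp add: sum.atLeastLessThan_concat)

lemma sum_sparse_block:
  assumes "m \<in> sparse" "knot m \<le> N" "N \<le> knot (Suc m)"
  shows "(\<Sum>k=knot m..<N. flattened k) = (real N - real (knot m)) * flat_incr m"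
proof -
  have "(\<Sum>k=knot m..<N. flattened k) = (\<Sum>k=knot m..<N. flat_incr m)"
    using assms by (intro sum.cong) (auto simp: flattened_eq_flat)
  then show ?thesis using assms by (simp add: of_nat_diff)
qed

lemma sum_plain_block:
  assumes "m \<notin> sparse" "knot m \<le> N" "N \<le> knot (Suc m)"
  shows "(\<Sum>k=knot m..<N. flattened k) = sqrt_log_growth N - sqrt_log_growth (knot m)"
proof -
  have "(\<Sum>k=knot m..<N. flattened k) = (\<Sum>k=knot m..<N. growth_incr k)"
    using assms by (intro sum.cong refl flattened_eq_incr) auto
  then show ?thesis using assms by (simp add: sum_growth_incr)
qed

lemma flattened_sum_knot: "flattened_sum (knot m) = sqrt_log_growth (knot m)"
proof (induction m)
  case 0
  show ?case using growth_knot[of 0] by (simp add: flattened_sum_def knot_def)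
next
  case (Suc m)
  have "(\<Sum>k=knot m..<knot (Suc m). flattened k) = 2 ^ m"
    using sum_sparse_block[of m "knot (Suc m)"] sum_plain_block[of m "knot (Suc m)"] knot_Suc_less[of m]
      flat_incr_mult[of m]
    by (cases "m \<in> sparse") (auto simp: growth_knot)
  then show ?case
    using flattened_sum_split[of "knot m" "knot (Suc m)"] knot_Suc_less[of m] Suc by (simp add: growth_knot)
qed

lemma flattened_sum_plain:
  assumes "m \<notin> sparse" "knot m \<le> N" "N \<le> knot (Suc m)"
  shows "flattened_sum N = sqrt_log_growth N"
  using flattened_sum_split[of "knot m" N] sum_plain_block[OF assms] assms flattened_sum_knot[of m] by simp

definition flattened_ratio :: "nat \<Rightarrow> real" where
  "flattened_ratio n = flattened_sum (Suc n) / sqrt_log_growth (1 + real n)"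

lemma growth_pos: "0 < t \<Longrightarrow> 0 < sqrt_log_growth t"
  by (simp add: sqrt_log_growth_def)

text \<open>Numerator and denominator both lie between \<open>2 ^ m - 1\<close> and \<open>2 ^ Suc m - 1\<close>, where \<open>m \<ge> 1\<close> is
  the index of the block.\<close>

lemma flattened_ratio_bounds: "0 < flattened_ratio n" "flattened_ratio n \<le> 3"
proof -
  have g: "0 < sqrt_log_growth (1 + real n)" by (rule growth_pos) simp
  have "0 < flattened_sum (Suc n)"
    unfolding flattened_sum_def by (intro sum_pos) (auto simp: flattened_pos)
  with g show "0 < flattened_ratio n" by (simp add: flattened_ratio_def)
  define m where "m = block (Suc n)"
  have m: "knot m \<le> Suc n" "Suc n < knot (Suc m)" using block_bounds unfolding m_def by auto
  have "m \<noteq> 0" using m by (intro notI) (simp add: knot_def)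
  then have "(2::real) ^ 1 \<le> 2 ^ m" by (intro power_increasing) auto
  have "flattened_sum (Suc n) \<le> flattened_sum (knot (Suc m))"
    unfolding flattened_sum_def using m flattened_pos by (intro sum_mono2) (auto simp: less_imp_le)
  also have "\<dots> = 2 * 2 ^ m - 1" by (simp add: flattened_sum_knot growth_knot)
  also have "\<dots> \<le> 3 * (2 ^ m - 1)" using \<open>2 ^ 1 \<le> 2 ^ m\<close> by simp
  also have "\<dots> \<le> 3 * sqrt_log_growth (1 + real n)"
    using growth_mono[of "knot m" "1 + real n"] m by (simp add: growth_knot)
  finally show "flattened_ratio n \<le> 3"
    using g by (simp add: flattened_ratio_def divide_le_eq)
qed

text \<open>The entry \<open>n\<close> belongs to the partial sum of length \<open>n + 1\<close> and to the unit interval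
  \<open>(n, n + 1]\<close>. As the ratio is \<open>1\<close> when \<open>n + 1\<close> is a knot, these unit intervals lie inside the
  flattened block and do not stick out at its left end.\<close>

lemma flattened_ratio_exceptional:
  assumes "flattened_ratio n \<noteq> 1"
  shows "\<exists>m\<in>sparse. knot m \<le> n \<and> n < knot (Suc m)"
proof -
  define m where "m = block (Suc n)"
  have m: "knot m \<le> Suc n" "Suc n < knot (Suc m)" using block_bounds unfolding m_def by auto
  have ne: "flattened_sum (Suc n) \<noteq> sqrt_log_growth (Suc n)"
    using assms growth_pos[of "1 + real n"] by (auto simp: flattened_ratio_def add.commute)
  then have "m \<in> sparse" using flattened_sum_plain[of m "Suc n"] m by auto
  moreover have "knot m \<noteq> Suc n" using ne flattened_sum_knot[of m] by auto
  ultimately show ?thesis using m by (intro bexI[of _ m]) auto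
qed

text \<open>A decreasing sequence is bounded by its averages, and the growth function is sublinear.\<close>

lemma flattened_tendsto_0: "flattened \<longlonglongrightarrow> 0"
proof (rule tendsto_sandwich[of "\<lambda>_. 0"])
  show "(\<lambda>n. 3 * sqrt_log_growth (1 + real n) / (1 + real n)) \<longlonglongrightarrow> 0"
    unfolding sqrt_log_growth_def by real_asymp
  have "flattened n \<le> 3 * sqrt_log_growth (1 + real n) / (1 + real n)" for n
  proof -
    have "real (card {..<Suc n}) * flattened n \<le> flattened_sum (Suc n)"
      unfolding flattened_sum_def
      by (rule sum_bounded_below) (use flattened_antimono in \<open>auto simp: decseq_def\<close>)
    also have "\<dots> \<le> 3 * sqrt_log_growth (1 + real n)"
      using flattened_ratio_bounds(2)[of n] growth_pos[of "1 + real n"]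
      by (simp add: flattened_ratio_def divide_le_eq)
    finally show ?thesis by (simp add: field_simps)
  qed
  then show "\<forall>\<^sub>F n in sequentially. flattened n \<le> 3 * sqrt_log_growth (1 + real n) / (1 + real n)"
    by simp
qed (auto simp: flattened_pos less_imp_le)

text \<open>At the knots the ratio is \<open>1\<close>. Near the logarithmic middle \<open>1 + mid m = 2 ^ (m\<^sup>2 + m)\<close> of a
  flattened block the chord has gained at most \<open>1\<close>, while
  \<open>sqrt (m\<^sup>2 + m) \<ge> m + 1 / 4\<close>; so there the upper limit of the ratio is at most \<open>2 powr (- 1 / 4)\<close>. The
  exact asymptotic shift is \<open>1 / 2\<close>, but any positive one suffices.\<close>

lemma flattened_ratio_not_convergent: "\<not> flattened_ratio \<longlonglongrightarrow> L"
proof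
  assume lim: "flattened_ratio \<longlonglongrightarrow> L"
  have knot_ratio: "flattened_ratio (knot m - 1) = 1" if "m \<noteq> 0" for m
  proof -
    have "Suc (knot m - 1) = knot m" using knot_ge[of m] that by simp
    moreover from this have "1 + real (knot m - 1) = real (knot m)" by linarith
    ultimately show ?thesis
      using flattened_sum_knot[of m] growth_pos[of "knot m"] by (simp add: flattened_ratio_def)
  qed
  have sub: "filterlim (\<lambda>j. (2::nat) ^ j) sequentially sequentially"
    by (rule filterlim_subseq) (simp add: strict_mono_def)
  have "filterlim (\<lambda>m. knot m - 1) sequentially sequentially"
    unfolding filterlim_at_top eventually_sequentially
    using knot_ge by (metis add_le_imp_le_diff le_trans)
  from filterlim_compose[OF lim this] have "(\<lambda>m. flattened_ratio (knot m - 1)) \<longlonglongrightarrow> L" .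
  moreover have "\<forall>\<^sub>F m in sequentially. flattened_ratio (knot m - 1) = 1"
    using eventually_gt_at_top[of 0] by eventually_elim (rule knot_ratio, simp)
  then have "(\<lambda>m. flattened_ratio (knot m - 1)) \<longlonglongrightarrow> 1"
    by (rule tendsto_eventually)
  ultimately have "L = 1"
    by (rule LIMSEQ_unique)
  define mid where "mid m = (2::nat) ^ (m\<^sup>2 + m) - 1" for m
  have one_mid: "1 + real (mid m) = 2 ^ (m\<^sup>2 + m)" for m
    by (simp add: mid_def of_nat_diff)
  have bound: "flattened_ratio (mid m - 1) \<le> 2 ^ m / (2 powr (real m + 1/4) - 1)" if m: "m \<in> sparse" for m
  proof -
    have "1 \<le> m" using m by auto
    have "m\<^sup>2 + m \<le> (Suc m)\<^sup>2" by (simp add: power2_eq_square)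
    then have le: "knot m \<le> mid m" "mid m \<le> knot (Suc m)"
      unfolding knot_def mid_def by (auto intro!: diff_le_mono power_increasing simp del: power_Suc)
    have "1 \<le> knot m" using knot_ge[of m] \<open>1 \<le> m\<close> by simp
    then have mid1: "1 \<le> mid m" using le by simp
    have "(real (mid m) - real (knot m)) * flat_incr m \<le> 1"
    proof -
      have a: "real (mid m) - real (knot m) = 2 ^ (m\<^sup>2) * (2 ^ m - 1)"
        using one_mid[of m] one_plus_knot[of m] by (simp add: power_add algebra_simps)
      have "(Suc m)\<^sup>2 = Suc (m\<^sup>2 + m + m)" by (simp add: power2_eq_square)
      then have "(2::real) ^ (Suc m)\<^sup>2 = 2 ^ (m\<^sup>2) * (2 * 2 ^ m * 2 ^ m)"
        by (simp only: power_Suc power_add mult_ac)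
      then have b: "real (knot (Suc m)) - real (knot m) = 2 ^ (m\<^sup>2) * (2 * 2 ^ m * 2 ^ m - 1)"
        using one_plus_knot[of "Suc m"] one_plus_knot[of m]
        unfolding right_diff_distrib mult_1_right by linarith
      have c: "1 \<le> (2::real) ^ m * 2 ^ m" using mult_mono[of 1 "(2::real) ^ m" 1 "2 ^ m"] by simp
      have "(2 ^ m - 1) * 2 ^ m \<le> 2 * 2 ^ m * 2 ^ m - (1::real)"
        using c by (simp add: algebra_simps add_increasing)
      then have "(2 ^ m - 1) * 2 ^ m / (2 * 2 ^ m * 2 ^ m - 1) \<le> (1::real)"
        using c by (simp add: divide_le_eq)
      then show ?thesis
        unfolding flat_incr_def a b by (simp add: mult.commute mult.left_commute)
    qed
    then have num: "flattened_sum (mid m) \<le> 2 ^ m"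
      using flattened_sum_split[OF le(1)] sum_sparse_block[OF m le] flattened_sum_knot[of m] growth_knot[of m]
      by simp
    have "(real m + 1/4)\<^sup>2 \<le> real (m\<^sup>2 + m)"
      using \<open>1 \<le> m\<close> by (simp add: power2_eq_square algebra_simps)
    then have "real m + 1/4 \<le> sqrt (log 2 (1 + real (mid m)))"
      unfolding one_mid by (intro real_le_rsqrt) (simp add: log_nat_power)
    then have den: "2 powr (real m + 1/4) - 1 \<le> sqrt_log_growth (mid m)"
      by (simp add: sqrt_log_growth_def)
    have "Suc (mid m - 1) = mid m" using mid1 by simp
    moreover from this have "1 + real (mid m - 1) = real (mid m)" by linarith
    ultimately have "flattened_ratio (mid m - 1) = flattened_sum (mid m) / sqrt_log_growth (mid m)"
      by (simp add: flattened_ratio_def)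
    also have "\<dots> \<le> 2 ^ m / (2 powr (real m + 1/4) - 1)"
      by (intro frac_le num den) auto
    finally show ?thesis .
  qed
  have mid_m: "m \<le> mid m" for m
  proof -
    have "m < 2 ^ m" by (rule less_exp)
    also have "(2::nat) ^ m \<le> 2 ^ (m\<^sup>2 + m)" by (intro power_increasing) auto
    finally show ?thesis by (simp add: mid_def)
  qed
  have "filterlim (\<lambda>m. mid m - 1) sequentially sequentially"
    unfolding filterlim_at_top eventually_sequentially
    using mid_m by (metis add_le_imp_le_diff le_trans)
  from filterlim_compose[OF lim filterlim_compose[OF this sub]]
  have "(\<lambda>j. flattened_ratio (mid (2 ^ j) - 1)) \<longlonglongrightarrow> L" .
  moreover have "(\<lambda>m. 2 ^ m / (2 powr (real m + 1/4) - 1)) \<longlonglongrightarrow> inverse (exp (ln 2 / 4))"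
    by real_asymp
  from filterlim_compose[OF this sub]
  have "(\<lambda>j. 2 ^ (2 ^ j) / (2 powr (real (2 ^ j) + 1/4) - 1)) \<longlonglongrightarrow> inverse (exp (ln 2 / 4))" .
  ultimately have "L \<le> inverse (exp (ln 2 / 4))"
    by (rule LIMSEQ_le) (use bound in blast)
  also have "\<dots> < (1::real)" by (simp add: inverse_less_1_iff)
  finally show False using \<open>L = 1\<close> by simp
qed

lemma sum_powers_of_two_le:
  assumes "finite Q" "Q \<subseteq> sparse" "\<And>m. m \<in> Q \<Longrightarrow> real m \<le> R" "0 \<le> R"
  shows "(\<Sum>m\<in>Q. real m) \<le> 2 * R"
proof (cases "Q = {}")
  case False
  with assms obtain J where J: "Max Q = 2 ^ J" by (meson Max_in imageE subsetD)
  have "Q \<subseteq> (\<lambda>j. 2 ^ j) ` {..J}"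
  proof
    fix m assume m: "m \<in> Q"
    then obtain j where "m = 2 ^ j" using assms by blast
    moreover have "m \<le> 2 ^ J" using m assms(1) J[symmetric] by simp
    ultimately show "m \<in> (\<lambda>j. 2 ^ j) ` {..J}" by auto
  qed
  then have "(\<Sum>m\<in>Q. real m) \<le> (\<Sum>m\<in>(\<lambda>j. 2 ^ j) ` {..J}. real m)"
    by (intro sum_mono2) auto
  also have "\<dots> = (\<Sum>j\<le>J. 2 ^ j)"
    by (subst sum.reindex) (auto simp: inj_on_def)
  also have "\<dots> \<le> 2 * real (Max Q)"
    unfolding J by (simp add: sum_gp atMost_atLeast0 flip: power_Suc)
  also have "\<dots> \<le> 2 * R" using assms False by simp
  finally show ?thesis .
qed (use assms in simp)

text \<open>The generous constant comes from \<open>(m + 1)\<^sup>2 - m\<^sup>2 + 1 = 2 * m + 2 \<le> 4 * m\<close>, the extra \<open>1\<close>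
  paying for the shift between \<open>knot m\<close> and \<open>1 + knot m \<le> 2 * knot m\<close>.\<close>

lemma log_length_block:
  assumes "m \<noteq> 0"
  shows "ln (knot (Suc m)) - ln (knot m) \<le> 4 * ln 2 * real m"
proof -
  have "0 < knot m" using strict_mono_less[OF strict_mono_knot, of 0 m] assms by simp
  have "real (knot (Suc m)) \<le> 2 ^ ((Suc m)\<^sup>2)"
    using one_plus_knot[of "Suc m"] by linarith
  also have "(Suc m)\<^sup>2 = m\<^sup>2 + (2 * m + 1)" by (simp add: power2_eq_square)
  also have "(2::real) ^ (m\<^sup>2 + (2 * m + 1)) = 2 ^ (2 * m + 1) * (1 + real (knot m))"
    unfolding one_plus_knot by (simp add: power_add mult.commute)
  also have "\<dots> \<le> 2 ^ (2 * m + 1) * (2 * real (knot m))"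
    using \<open>0 < knot m\<close> by (intro mult_left_mono) auto
  also have "\<dots> = 2 ^ (2 * m + 2) * real (knot m)" by simp
  also have "\<dots> \<le> 2 ^ (4 * m) * real (knot m)"
    using assms by (intro mult_right_mono power_increasing) auto
  finally have "ln (real (knot (Suc m))) \<le> ln (2 ^ (4 * m) * real (knot m))"
    using \<open>0 < knot m\<close> knot_Suc_less[of m] by (subst ln_le_cancel_iff) auto
  then show ?thesis
    using \<open>0 < knot m\<close> by (simp add: ln_mult ln_realpow algebra_simps)
qed

text \<open>Below \<open>t\<close> only blocks with \<open>m \<le> sqrt (log 2 (1 + t))\<close> begin, so the logarithmic length of the
  flattened ones is of order \<open>sqrt (log 2 (1 + t))\<close>, which is negligible against \<open>ln t\<close>.\<close>

lemma log_mean_flattened_ratio: "(log_mean (step_fun flattened_ratio) \<longlongrightarrow> 1) at_top"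
proof -
  have "((\<lambda>t. log_mean (step_fun flattened_ratio) t - 1) \<longlongrightarrow> 0) at_top"
  proof (rule Lim_null_comparison)
    show "((\<lambda>t. 2 * (4 * ln 2 * (2 * sqrt (log 2 (1 + t)))) / ln t) \<longlongrightarrow> (0::real)) at_top"
      by real_asymp
    show "\<forall>\<^sub>F t in at_top. norm (log_mean (step_fun flattened_ratio) t - 1)
        \<le> 2 * (4 * ln 2 * (2 * sqrt (log 2 (1 + t)))) / ln t"
      using eventually_gt_at_top[of 1]
    proof eventually_elim
      case (elim t)
      define Q where "Q = {m \<in> sparse. real (knot m) < t}"
      define R where "R = sqrt (log 2 (1 + t))"
      have Q_le: "real m \<le> R" if "m \<in> Q" for m
      proof -
        have "2 powr ((real m)\<^sup>2) = 1 + real (knot m)"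
          unfolding one_plus_knot by (simp flip: powr_realpow)
        also have "\<dots> \<le> 1 + t" using that by (simp add: Q_def)
        finally have "(real m)\<^sup>2 \<le> log 2 (1 + t)"
          using elim by (simp add: le_log_iff)
        then show ?thesis unfolding R_def by (rule real_le_rsqrt)
      qed
      have "Q \<subseteq> {..nat \<lfloor>R\<rfloor>}" using Q_le by (auto simp: le_nat_floor)
      then have fin: "finite Q" using finite_subset by blast
      have nz: "m \<noteq> 0" if "m \<in> Q" for m using that by (auto simp: Q_def)
      have "\<bar>log_mean (step_fun flattened_ratio) t - 1\<bar>
          \<le> 2 * (\<Sum>m\<in>Q. ln (knot (Suc m)) - ln (knot m)) / ln t"
      proof (rule log_mean_deviation_bound[OF elim _ fin])
        show "\<bar>flattened_ratio n - 1\<bar> \<le> 2" for n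
          using flattened_ratio_bounds[of n] by simp
        show "0 < knot m \<and> knot m \<le> knot (Suc m)" if "m \<in> Q" for m
          using strict_mono_less[OF strict_mono_knot, of 0 m] nz[OF that] knot_Suc_less[of m] by simp
        show "\<exists>m\<in>Q. knot m \<le> n \<and> n < knot (Suc m)" if "real n < t" "flattened_ratio n \<noteq> 1" for n
          using flattened_ratio_exceptional[OF that(2)] that(1) unfolding Q_def by force
      qed
      also have "(\<Sum>m\<in>Q. ln (knot (Suc m)) - ln (knot m)) \<le> (\<Sum>m\<in>Q. 4 * ln 2 * real m)"
        by (intro sum_mono log_length_block nz)
      also have "\<dots> = 4 * ln 2 * (\<Sum>m\<in>Q. real m)" by (simp add: sum_distrib_left)
      also have "(\<Sum>m\<in>Q. real m) \<le> 2 * R"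
        by (rule sum_powers_of_two_le[OF fin]) (use Q_le elim in \<open>auto simp: Q_def R_def\<close>)
      finally show ?case using elim by (simp add: R_def divide_right_mono)
    qed
  qed
  then show ?thesis by (rule LIM_zero_cancel)
qed


section \<open>The operator\<close>

lemma gen_limit_log_mean:
  assumes "gen_limit_fun \<gamma>" "\<And>n. \<bar>x n\<bar> \<le> C" "(log_mean (step_fun x) \<longlongrightarrow> l) at_top"
  shows "(\<gamma> \<circ> log_mean \<circ> step_fun) x = l"
  using assms log_mean_step_fun_L_infinity[of x C] by (simp add: gen_limit_fun_def)

theorem theorem3p4:
  fixes \<psi> :: "real \<Rightarrow> real"
  assumes psi: "\<forall>t\<ge>0. \<psi> t = 2 powr sqrt (log 2 (1 + t)) - 1"
    and infinite_dim: "infinite_dimensional TYPE('h::complex_hilbert_space)"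
    and separable: "separable TYPE('h)"
  shows "\<exists>T\<^sub>0 :: 'h \<Rightarrow> 'h.
           T\<^sub>0 \<in> marcinkiewicz \<psi> \<and> positive_op T\<^sub>0 \<and> connes_dixmier_measurable \<psi> T\<^sub>0 \<and>
           \<not> (\<exists>L. (\<lambda>n. 1 / \<psi> (real n + 1) * (\<Sum>k=0..n. singular_value k T\<^sub>0)) \<longlonglongrightarrow> L)"
proof -
  obtain e :: "nat \<Rightarrow> 'h" where e: "orthonormal_seq e"
    using orthonormal_seq_exists[OF infinite_dim] by blast
  have pos: "\<forall>k. 0 < flattened k" by (simp add: flattened_pos)
  note hyps = e flattened_antimono flattened_tendsto_0 pos
  define T where "T = diag_op e flattened"
  have psi_growth: "\<psi> (1 + real n) = sqrt_log_growth (1 + real n)" for n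
    using psi by (simp add: sqrt_log_growth_def)
  have mean: "singular_mean \<psi> T = flattened_ratio"
    by (simp add: fun_eq_iff singular_mean_def T_def singular_value_diag_op[OF hyps] psi_growth
        flattened_ratio_def flattened_sum_def lessThan_Suc_atMost atMost_atLeast0)
  have mean_zero: "singular_mean \<psi> (\<lambda>x::'h. 0) = (\<lambda>n. 0)"
    by (simp add: fun_eq_iff singular_mean_def singular_value_zero)
  have marcinkiewicz: "T \<in> marcinkiewicz \<psi>"
    using compact_diag_op[OF hyps] bdd_aboveI2[of UNIV flattened_ratio 3] flattened_ratio_bounds(2)
    by (simp add: marcinkiewicz_def mean flip: T_def)
  have positive: "positive_op T"
    unfolding T_def
    by (rule positive_diag_op[OF e abs_s_le[OF hyps]]) (simp add: flattened_pos less_imp_le)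
  have trace: "\<tau> T = 1" if "\<tau> \<in> connes_dixmier_traces \<psi>" for \<tau> :: "('h \<Rightarrow> 'h) \<Rightarrow> complex"
  proof -
    obtain \<gamma> where \<gamma>: "gen_limit_fun \<gamma>" and \<tau>: "\<tau> = dixmier_trace \<psi> (\<gamma> \<circ> log_mean \<circ> step_fun)"
      using \<open>\<tau> \<in> connes_dixmier_traces \<psi>\<close> by (auto simp: connes_dixmier_traces_def)
    have "(\<gamma> \<circ> log_mean \<circ> step_fun) flattened_ratio = 1"
      using flattened_ratio_bounds
      by (intro gen_limit_log_mean[OF \<gamma> _ log_mean_flattened_ratio, of 3]) (simp add: less_imp_le)
    moreover have "(\<gamma> \<circ> log_mean \<circ> step_fun) (\<lambda>n. 0) = 0"
    proof (rule gen_limit_log_mean[OF \<gamma>, of _ 0])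
      have "log_mean (step_fun (\<lambda>n. 0)) = (\<lambda>t. 0)"
        by (simp add: fun_eq_iff log_mean_def step_fun_def interval_lebesgue_integral_def
            set_lebesgue_integral_def)
      then show "(log_mean (step_fun (\<lambda>n. 0)) \<longlongrightarrow> 0) at_top" by simp
    qed simp
    ultimately show ?thesis
      using dixmier_trace_positive[of T] adjoint_diag_op[OF hyps] abs_diag_op[OF hyps]
      by (simp add: \<tau> T_def[symmetric] dixmier_weight_def mean mean_zero)
  qed
  have "\<not> (\<lambda>n. 1 / \<psi> (real n + 1) * (\<Sum>k=0..n. singular_value k T)) \<longlonglongrightarrow> L" for L
    using flattened_ratio_not_convergent[of L] mean
    by (simp add: singular_mean_def[abs_def] add.commute)
  moreover have "connes_dixmier_measurable \<psi> T"
    unfolding connes_dixmier_measurable_def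
  proof (intro conjI ballI marcinkiewicz)
    fix \<tau> \<tau>' :: "('h \<Rightarrow> 'h) \<Rightarrow> complex"
    assume "\<tau> \<in> connes_dixmier_traces \<psi>" "\<tau>' \<in> connes_dixmier_traces \<psi>"
    then show "\<tau> T = \<tau>' T" using trace[of \<tau>] trace[of \<tau>'] by simp
  qed
  ultimately show ?thesis using marcinkiewicz positive by blast
qed

end
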